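(* Let $K\subset\mathbb{RP}^3$ be a positive knot. Let $n$ be the number of crossings in a positive diagram of $K$ in $\mathbb{RP}^2$, and let $r$ be the number of circles in the oriented resolution of that diagram. Then $$s(K)=n-r+1,$$ where $s$ is the $s$-invariant of links in $\mathbb{RP}^3$.
   Context: A knot in $\mathbb{RP}^3$ is positive if it admits a diagram in $\mathbb{RP}^2$ with only positive crossings (a positive diagram). Diagrams: $\mathbb{RP}^3$ minus a point is identified with the twisted $I$-bundle over $\mathbb{RP}^2$. A diagram $D\subset\mathbb{RP}^2$ of a link $L\subset\mathbb{RP}^3$ is a tangle diagram in an oriented disk whose ends are pairs of antipodal boundary points (antipodal boundary points being identified to form $\mathbb{RP}^2$), such that lifting $D$ to the $I$-bundle with overstrands on top gives a link isotopic to $L$. Resolutions: let $D$ have $n$ ordered crossings. Draw a crossing with overstrand joining SW and NE and understrand joining NW and SE; its $0$-resolution consists of the two vertical arcs NW–SW and NE–SE, its $1$-resolution of the two horizontal arcs NW–NE and SW–SE. A vertex $v\in\{0,1\}^n$, with $|v|$ the sum of its entries, gives a resolution $D_v$: disjoint circles in $\mathbb{RP}^2$, at most one of which is homologically essential; the others are called trivial. An edge $e:u\to v$ of the cube changes one entry of $u$ from $0$ to $1$; it is a 2-1, 1-2 or 1-1 bifurcation according to whether passing from $D_u$ to $D_v$ merges two circles, splits a circle into two, or turns one circle into one circle. Auxiliary diagram choices for $D$: a local orientation of the two strands at each crossing, an ordering of the circles of each $D_v$, and an orientation of each circle of each $D_v$. Lee complex: let $V=\mathbb{Q}\langle 1,X\rangle$,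 $\overline V=\mathbb{Q}\langle\overline 1,\overline X\rangle$. $C(D_v)$ is the tensor product, in the chosen order of circles, of a copy of $V$ for each trivial circle and of $\overline V$ for the essential circle (if present); its generators are the labellings of the circles by $1,X$ (resp. $\overline1,\overline X$). For $D$ oriented with $n^+$ positive and $n^-$ negative crossings, a generator has quantum grading $j=|v|+\#(\text{labels }1,\overline1)-\#(\text{labels }X,\overline X)+n^+-2n^-$. $LC^*(D)=\bigoplus_vC(D_v)$ with differential $\partial=\sum_e\partial^e$ over all edges, and $LH^*(D)$ is its homology. For a 1-1 bifurcation $\partial^e=0$. Otherwise, up to the signs below, $\partial^e:C(D_u)\to C(D_v)$ is the identity on the circles away from the crossing and on the circles involved it is multiplication $m$ (2-1) or comultiplication $\Delta$ (1-2): on trivial circles $m(1\otimes1)=1$, $m(1\otimes X)=m(X\otimes1)=X$, $m(X\otimes X)=1$, $\Delta(1)=1\otimes X+X\otimes1$, $\Delta(X)=X\otimes X+1\otimes1$; with an essential circle $m(\overline1\otimes1)=\overline1$, $m(\overline1\otimes X)=\overline X$, $m(\overline X\otimes1)=\overline X$, $m(\overline X\otimes X)=\overline1$, $\Delta(\overline1)=\overline1\otimes X+\overline X\otimes1$, $\Delta(\overline X)=\overline X\otimes X+\overline1\otimes1$, and the same with tensor factors interchanged. Signs: let $c$ be the crossing of $e:u\to v$; choose compass directions at $c$ so that, with the chosen local orientation, the strands run from SW to NE and from SE to NW. Circles of $D_u,D_v$ meeting a neighbourhood of $c$ are near, the others far. $\partial^e$ carries the product of three signs. (P) $\mathrm{sgn}(\sigma_u)\,\mathrm{sgn}(\sigma_v^{-1})$,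 where $\sigma_u$ (resp. $\sigma_v$) is the permutation of the ordered circles of $D_u$ (resp. $D_v$) putting first the near circle to the west/north of $c$ (containing the arc NW–SW or NW–NE), second the other near circle if there is one, and keeping the order of the rest. (O) On a generator $g$: $(-1)^{N}$ with $N$ the number of far circles labelled $X$ or $\overline X$ by $g$ and oriented differently in $D_u$ and $D_v$. (C) On a generator $h$ occurring in $\partial^e(g)$: $(-1)^{N'}$ with $N'$ the number of near circles that are inconsistent and labelled $X$ or $\overline X$ (in $D_u$ by $g$, or in $D_v$ by $h$); a near circle is consistent if its orientation agrees with the local orientation of $c$ at the NE corner, or disagrees with it at the SW corner, and inconsistent otherwise (the two tests agree when both apply). Lee generators: let $o$ be the orientation of $D$, $\bar o$ its opposite, and $D_o=D_{\bar o}$ the oriented resolution; local orientations at crossings are those induced by $o$. A dividing circle for $D_o$ is an oriented homologically essential circle $\mathcal C\subset\mathbb{RP}^2$ equal to the essential circle of $D_o$ if there is one, and disjoint from $D_o$ otherwise. It induces an orientation $o_{\mathcal C}$ of $D_o$: identify the complement of $\mathcal C$ with a disk oriented so that its boundary orientation is that of $\mathcal C$; a circle $\mathcal C'\neq\mathcal C$ of $D_o$ is oriented counterclockwise iff its distance from $\mathcal C$ (one plus the minimal number of other circles of $D_o$ that a path from $\mathcal C$ to $\mathcal C'$ must intersect) is even; $\mathcal C$ itself, if in $D_o$, keeps its orientation. Use auxiliary choices orienting $D_o$ by $o_{\mathcal C}$. Put $a=1+X$, $b=1-X$, $\overline a=\overline1+\overline X$, $\overline b=\overline1-\overline X$. Then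 $\mathfrak s_o\in C(D_o)$ (resp. $\mathfrak s_{\bar o}$) is the labelling of each circle of $D_o$ by $a$ ($\overline a$ on the essential circle) if the orientation induced by $o$ (resp. $\bar o$) agrees with $o_{\mathcal C}$ on it, and by $b$ ($\overline b$) otherwise. These are cycles. $s$-invariant: for a class $z\in LH^*(D)$, $\mathrm q(z)$ is the largest $j_0$ such that $z$ is represented by a cycle in the subcomplex of $LC^*(D)$ spanned by generators with $j\ge j_0$. For an oriented link $L$ with diagram $(D,o)$, $s(L)=\frac12\big(\mathrm q([\mathfrak s_o+\mathfrak s_{\bar o}])+\mathrm q([\mathfrak s_o-\mathfrak s_{\bar o}])\big)$; this does not depend on the choices made. *)

theory Defs
  imports Complex_Main "HOL-Library.FuncSet" "HOL-Combinatorics.Permutations"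
begin

text \<open>
  Link diagrams in the real projective plane.  A diagram is a tangle diagram in an oriented disk
  with antipodal boundary points identified.  The disk is drawn as a rectangle, oriented as the
  page, and the tangle is put in Morse position: it is a sequence of local events read from bottom
  to top, each of which lives in a horizontal slab.  A pair \<open>(m, es)\<close> is the diagram with
  \<open>m\<close> ends on the bottom and \<open>m\<close> ends on the top side and with events \<open>es\<close>;
  the antipode of the \<open>k\<close>-th top end (counted from the left, from 0) is the
  \<open>(m - 1 - k)\<close>-th bottom end.  Every diagram in the projective plane (possibly
  disconnected, with \<open>m = 0\<close> or without crossings) is isotopic to one of this form.

  The event \<open>Cup i\<close> creates two strands in positions \<open>i\<close> and \<open>i + 1\<close>
  joined by a local minimum; \<open>Cap i\<close> joins the strands in these positions by a local maximum;
  \<open>Cross b i\<close> is a crossing of the two strands, in which the strand from the lower left to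
  the upper right is the overstrand iff \<open>b\<close>.  The two resolutions of a crossing are
  \<open>Vert i\<close> (two vertical arcs) and \<open>Turn i\<close> (two horizontal arcs, i.e. a local
  maximum below a local minimum).
\<close>

datatype event = Cup nat | Cap nat | Cross bool nat | Vert nat | Turn nat

type_synonym diagram = "nat \<times> event list"

fun fits :: "event \<Rightarrow> nat \<Rightarrow> bool" where
  "fits (Cup i) w \<longleftrightarrow> i \<le> w"
| "fits (Cap i) w \<longleftrightarrow> i + 2 \<le> w"
| "fits (Cross b i) w \<longleftrightarrow> i + 2 \<le> w"
| "fits (Vert i) w \<longleftrightarrow> i + 2 \<le> w"
| "fits (Turn i) w \<longleftrightarrow> i + 2 \<le> w"

fun width_above :: "event \<Rightarrow> nat \<Rightarrow> nat" where
  "width_above (Cup i) w = w + 2"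
| "width_above (Cap i) w = w - 2"
| "width_above _ w = w"

text \<open>Number of strands at level \<open>t\<close>, i.e. just before event \<open>t\<close>.\<close>

definition width :: "diagram \<Rightarrow> nat \<Rightarrow> nat" where
  "width D t = fold width_above (take t (snd D)) (fst D)"

definition height :: "diagram \<Rightarrow> nat" where
  "height D = length (snd D)"

definition well_formed :: "diagram \<Rightarrow> bool" where
  "well_formed D \<longleftrightarrow>
     (\<forall>t < height D. fits (snd D ! t) (width D t)) \<and> width D (height D) = fst D"

definition link_diagram :: "diagram \<Rightarrow> bool" where
  "link_diagram D \<longleftrightarrow>
     well_formed D \<and> (\<forall>e \<in> set (snd D). \<forall>i. e \<noteq> Vert i \<and> e \<noteq> Turn i)"

text \<open>The point \<open>(t, k)\<close> is the intersection of the \<open>k\<close>-th strand with level \<open>t\<close>.\<close>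

type_synonym point = "nat \<times> nat"

definition points :: "diagram \<Rightarrow> point set" where
  "points D = {(t, k). t \<le> height D \<and> k < width D t}"

text \<open>\<open>passes e k k'\<close>: a strand of the slab of \<open>e\<close> runs from bottom position
  \<open>k\<close> to top position \<open>k'\<close>.\<close>

fun passes :: "event \<Rightarrow> nat \<Rightarrow> nat \<Rightarrow> bool" where
  "passes (Cup i) k k' \<longleftrightarrow> (k < i \<and> k' = k) \<or> (i \<le> k \<and> k' = k + 2)"
| "passes (Cap i) k k' \<longleftrightarrow> (k' < i \<and> k = k') \<or> (i \<le> k' \<and> k = k' + 2)"
| "passes (Cross b i) k k' \<longleftrightarrow> k' = transpose i (i + 1) k"
| "passes (Vert i) k k' \<longleftrightarrow> k' = k"
| "passes (Turn i) k k' \<longleftrightarrow> k' = k \<and> k \<noteq> i \<and> k \<noteq> i + 1"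

fun minima :: "event \<Rightarrow> nat set" where
  "minima (Cup i) = {i}"
| "minima (Turn i) = {i}"
| "minima _ = {}"

fun maxima :: "event \<Rightarrow> nat set" where
  "maxima (Cap i) = {i}"
| "maxima (Turn i) = {i}"
| "maxima _ = {}"

text \<open>Arcs along which the vertical direction of travel is kept, resp. reversed.  Passing to the
  antipode keeps it: leaving the disk upwards at the top means entering it upwards at the bottom.\<close>

inductive straight :: "diagram \<Rightarrow> point \<Rightarrow> point \<Rightarrow> bool" for D where
  through: "t < height D \<Longrightarrow> k < width D t \<Longrightarrow> passes (snd D ! t) k k' \<Longrightarrow>
    straight D (t, k) (Suc t, k')"
| antipodal: "k < fst D \<Longrightarrow> straight D (height D, k) (0, fst D - 1 - k)"

inductive turning :: "diagram \<Rightarrow> point \<Rightarrow> point \<Rightarrow> bool" for D where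
  minimum: "t < height D \<Longrightarrow> i \<in> minima (snd D ! t) \<Longrightarrow> turning D (Suc t, i) (Suc t, i + 1)"
| maximum: "t < height D \<Longrightarrow> i \<in> maxima (snd D ! t) \<Longrightarrow> turning D (t, i) (t, i + 1)"

definition joined :: "diagram \<Rightarrow> point \<Rightarrow> point \<Rightarrow> bool" where
  "joined D p q \<longleftrightarrow> straight D p q \<or> turning D p q"

text \<open>The closed curves of a diagram, as sets of points: the components of the link for a link
  diagram, the circles of the resolution for a resolved diagram.\<close>

definition circles :: "diagram \<Rightarrow> point set set" where
  "circles D = {{q. equivclp (joined D) p q} | p. p \<in> points D}"

definition knot_diagram :: "diagram \<Rightarrow> bool" where
  "knot_diagram D \<longleftrightarrow> link_diagram D \<and> card (circles D) = 1"

text \<open>A circle is homologically essential iff it meets the line at infinity (the image of the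
  boundary of the disk) an odd number of times.\<close>

definition essential :: "diagram \<Rightarrow> point set \<Rightarrow> bool" where
  "essential D C \<longleftrightarrow> odd (card {k. k < fst D \<and> (height D, k) \<in> C})"

text \<open>An orientation tells whether the strand through a point is directed upwards.\<close>

type_synonym orientation = "point \<Rightarrow> bool"

definition orients :: "orientation \<Rightarrow> diagram \<Rightarrow> bool" where
  "orients \<omega> D \<longleftrightarrow>
     (\<forall>p q. straight D p q \<longrightarrow> \<omega> p = \<omega> q) \<and> (\<forall>p q. turning D p q \<longrightarrow> \<omega> p \<noteq> \<omega> q)"

definition opposite :: "orientation \<Rightarrow> orientation" where
  "opposite \<omega> = (\<lambda>p. \<not> \<omega> p)"


text \<open>Crossings are named by the index of their event; their corners are points of the diagram.\<close>

definition crossings :: "diagram \<Rightarrow> nat set" where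
  "crossings D = {c. c < height D \<and> (\<exists>b i. snd D ! c = Cross b i)}"

fun site :: "event \<Rightarrow> nat" where
  "site (Cup i) = i"
| "site (Cap i) = i"
| "site (Cross b i) = i"
| "site (Vert i) = i"
| "site (Turn i) = i"

definition page_sw :: "diagram \<Rightarrow> nat \<Rightarrow> point" where
  "page_sw D c = (c, site (snd D ! c))"
definition page_se :: "diagram \<Rightarrow> nat \<Rightarrow> point" where
  "page_se D c = (c, site (snd D ! c) + 1)"
definition page_ne :: "diagram \<Rightarrow> nat \<Rightarrow> point" where
  "page_ne D c = (Suc c, site (snd D ! c) + 1)"
definition page_nw :: "diagram \<Rightarrow> nat \<Rightarrow> point" where
  "page_nw D c = (Suc c, site (snd D ! c))"

definition corners :: "diagram \<Rightarrow> nat \<Rightarrow> point set" where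
  "corners D c = {page_sw D c, page_se D c, page_ne D c, page_nw D c}"

text \<open>With both strands directed upwards, a crossing is positive iff its overstrand runs from the
  lower left to the upper right; reversing one strand changes the sign.\<close>

definition positive_crossing :: "diagram \<Rightarrow> orientation \<Rightarrow> nat \<Rightarrow> bool" where
  "positive_crossing D \<omega> c \<longleftrightarrow>
     (\<exists>b i. snd D ! c = Cross b i \<and> b = (\<omega> (page_sw D c) = \<omega> (page_se D c)))"

definition n_pos :: "diagram \<Rightarrow> orientation \<Rightarrow> nat" where
  "n_pos D \<omega> = card {c \<in> crossings D. positive_crossing D \<omega> c}"

definition n_neg :: "diagram \<Rightarrow> orientation \<Rightarrow> nat" where
  "n_neg D \<omega> = card {c \<in> crossings D. \<not> positive_crossing D \<omega> c}"

definition positive_diagram :: "diagram \<Rightarrow> orientation \<Rightarrow> bool" where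
  "positive_diagram D \<omega> \<longleftrightarrow> (\<forall>c \<in> crossings D. positive_crossing D \<omega> c)"


text \<open>A vertex of the cube is given by the set of crossings that receive the 1-resolution.  If the
  overstrand runs from the lower left to the upper right, the 0-resolution consists of the two
  vertical arcs; for the other kind of crossing turn the page by 90 degrees.\<close>

type_synonym vertex = "nat set"

fun smoothing :: "bool \<Rightarrow> event \<Rightarrow> event" where
  "smoothing one (Cross b i) = (if b = one then Turn i else Vert i)"
| "smoothing one e = e"

definition resolve :: "diagram \<Rightarrow> vertex \<Rightarrow> diagram" where
  "resolve D v = (fst D, map (\<lambda>t. smoothing (t \<in> v) (snd D ! t)) [0..<height D])"

text \<open>The oriented resolution is the one that inherits the orientation of the diagram.\<close>

definition oriented_vertex :: "diagram \<Rightarrow> orientation \<Rightarrow> vertex" where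
  "oriented_vertex D \<omega> = (THE v. v \<subseteq> crossings D \<and> orients \<omega> (resolve D v))"

definition oriented_resolution :: "diagram \<Rightarrow> orientation \<Rightarrow> diagram" where
  "oriented_resolution D \<omega> = resolve D (oriented_vertex D \<omega>)"


text \<open>Auxiliary choices.  \<open>strands_up A c\<close> gives the local orientation at \<open>c\<close>:
  whether the strand between the lower left and the upper right corner, and the strand between the
  lower right and the upper left corner, are directed upwards.\<close>

record aux =
  strands_up :: "nat \<Rightarrow> bool \<times> bool"
  circle_order :: "vertex \<Rightarrow> point set list"
  circle_dir :: "vertex \<Rightarrow> orientation"

definition auxiliary_choices :: "diagram \<Rightarrow> aux \<Rightarrow> bool" where
  "auxiliary_choices D A \<longleftrightarrow> (\<forall>v \<subseteq> crossings D.
     distinct (circle_order A v) \<and> set (circle_order A v) = circles (resolve D v) \<and>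
     orients (circle_dir A v) (resolve D v))"

definition local_up :: "diagram \<Rightarrow> aux \<Rightarrow> nat \<Rightarrow> point \<Rightarrow> bool" where
  "local_up D A c p =
     (if p = page_sw D c \<or> p = page_ne D c then fst (strands_up A c) else snd (strands_up A c))"

text \<open>The corners SW, SE, NE, NW of \<open>c\<close>, in this order, with respect to the compass directions
  for which the strands run from SW to NE and from SE to NW: the corners of the page, rotated.\<close>

definition compass :: "diagram \<Rightarrow> aux \<Rightarrow> nat \<Rightarrow> point \<times> point \<times> point \<times> point" where
  "compass D A c =
     (let sw = page_sw D c; se = page_se D c; ne = page_ne D c; nw = page_nw D c in
      case strands_up A c of
        (True, True) \<Rightarrow> (sw, se, ne, nw)
      | (True, False) \<Rightarrow> (nw, sw, se, ne)
      | (False, False) \<Rightarrow> (ne, nw, sw, se)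
      | (False, True) \<Rightarrow> (se, ne, nw, sw))"

definition corner_SW :: "diagram \<Rightarrow> aux \<Rightarrow> nat \<Rightarrow> point" where
  "corner_SW D A c = (case compass D A c of (sw, se, ne, nw) \<Rightarrow> sw)"
definition corner_NE :: "diagram \<Rightarrow> aux \<Rightarrow> nat \<Rightarrow> point" where
  "corner_NE D A c = (case compass D A c of (sw, se, ne, nw) \<Rightarrow> ne)"
definition corner_NW :: "diagram \<Rightarrow> aux \<Rightarrow> nat \<Rightarrow> point" where
  "corner_NW D A c = (case compass D A c of (sw, se, ne, nw) \<Rightarrow> nw)"


text \<open>The Lee complex.  The basis of V and the basis of its barred copy share the labels
  \<open>L1\<close> (for 1) and \<open>LX\<close> (for X): which copy is meant is determined by whether the
  circle is essential, and the formulas for the maps are the same in all cases.\<close>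

datatype label = L1 | LX

fun mult :: "label \<Rightarrow> label \<Rightarrow> label" where
  "mult L1 L1 = L1"
| "mult L1 LX = LX"
| "mult LX L1 = LX"
| "mult LX LX = L1"

text \<open>The comultiplication is the sum of the following pairs of labels.\<close>

fun comult :: "label \<Rightarrow> (label \<times> label) set" where
  "comult L1 = {(L1, LX), (LX, L1)}"
| "comult LX = {(LX, LX), (L1, L1)}"

type_synonym labelling = "point set \<Rightarrow> label"
type_synonym generator = "vertex \<times> labelling"
type_synonym chain = "generator \<Rightarrow> rat"

definition labellings :: "diagram \<Rightarrow> vertex \<Rightarrow> labelling set" where
  "labellings D v = (circles (resolve D v) \<rightarrow>\<^sub>E UNIV)"

definition generators :: "diagram \<Rightarrow> generator set" where
  "generators D = {(v, g). v \<subseteq> crossings D \<and> g \<in> labellings D v}"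

definition chains :: "diagram \<Rightarrow> chain set" where
  "chains D = {x. \<forall>g. g \<notin> generators D \<longrightarrow> x g = 0}"

definition quantum_grading :: "diagram \<Rightarrow> orientation \<Rightarrow> generator \<Rightarrow> int" where
  "quantum_grading D \<omega> = (\<lambda>(v, g).
     int (card v) + int (card {C \<in> circles (resolve D v). g C = L1})
     - int (card {C \<in> circles (resolve D v). g C = LX})
     + int (n_pos D \<omega>) - 2 * int (n_neg D \<omega>))"

definition near :: "diagram \<Rightarrow> vertex \<Rightarrow> nat \<Rightarrow> point set set" where
  "near D v c = {C \<in> circles (resolve D v). C \<inter> corners D c \<noteq> {}}"

text \<open>For an edge at \<open>c\<close> the far circles of both ends coincide, as sets of points.\<close>

definition far :: "diagram \<Rightarrow> vertex \<Rightarrow> nat \<Rightarrow> point set set" where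
  "far D v c = circles (resolve D v) - near D v c"

text \<open>\<open>arranged D A u v c\<close> lists the circles of the vertex \<open>v\<close> with the near circles at
  \<open>c\<close> first, the one containing the NW corner leading.  The far circles follow in the order of
  the source \<open>u\<close> of the edge.  This fixes what keeping the order of the far circles means when
  the chosen orders of the far circles in the two ends of the edge differ: for the differential to
  square to zero, the two rearranged tensor products must have their far factors in the same order.\<close>

definition arranged :: "diagram \<Rightarrow> aux \<Rightarrow> vertex \<Rightarrow> vertex \<Rightarrow> nat \<Rightarrow> point set list" where
  "arranged D A u v c =
     filter (\<lambda>C. C \<in> near D v c \<and> corner_NW D A c \<in> C) (circle_order A v) @
     filter (\<lambda>C. C \<in> near D v c \<and> corner_NW D A c \<notin> C) (circle_order A v) @
     filter (\<lambda>C. C \<in> far D u c) (circle_order A u)"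

text \<open>The permutation of positions that takes the list \<open>xs\<close> to its rearrangement \<open>ys\<close>.\<close>

definition rearrangement :: "'a list \<Rightarrow> 'a list \<Rightarrow> nat \<Rightarrow> nat" where
  "rearrangement xs ys i =
     (if i < length xs then (THE j. j < length ys \<and> ys ! j = xs ! i) else i)"

definition sign_P :: "diagram \<Rightarrow> aux \<Rightarrow> vertex \<Rightarrow> nat \<Rightarrow> rat" where
  "sign_P D A u c =
     (let v = insert c u;
          \<sigma>u = rearrangement (circle_order A u) (arranged D A u u c);
          \<sigma>v = rearrangement (circle_order A v) (arranged D A u v c)
      in of_int (sign \<sigma>u) * of_int (sign (inv \<sigma>v)))"

definition sign_O :: "diagram \<Rightarrow> aux \<Rightarrow> vertex \<Rightarrow> nat \<Rightarrow> labelling \<Rightarrow> rat" where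
  "sign_O D A u c g =
     (- 1) ^ card {C \<in> far D u c. g C = LX \<and>
       (\<exists>p \<in> C. circle_dir A u p \<noteq> circle_dir A (insert c u) p)}"

definition consistent :: "diagram \<Rightarrow> aux \<Rightarrow> vertex \<Rightarrow> nat \<Rightarrow> point set \<Rightarrow> bool" where
  "consistent D A v c C \<longleftrightarrow>
     (let NE = corner_NE D A c; SW = corner_SW D A c in
       (NE \<in> C \<and> circle_dir A v NE = local_up D A c NE) \<or>
       (SW \<in> C \<and> circle_dir A v SW \<noteq> local_up D A c SW))"

definition sign_C :: "diagram \<Rightarrow> aux \<Rightarrow> vertex \<Rightarrow> nat \<Rightarrow> labelling \<Rightarrow> labelling \<Rightarrow> rat" where
  "sign_C D A u c g h =
     (let v = insert c u in
      (- 1) ^ (card {C \<in> near D u c. \<not> consistent D A u c C \<and> g C = LX} +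
               card {C \<in> near D v c. \<not> consistent D A v c C \<and> h C = LX}))"

text \<open>Whether \<open>h\<close> occurs in the image of \<open>g\<close> under the edge that changes the entry
  \<open>c\<close> of the vertex \<open>u\<close>.  This never happens for a 1-1 bifurcation.\<close>

definition occurs :: "diagram \<Rightarrow> aux \<Rightarrow> vertex \<Rightarrow> nat \<Rightarrow> labelling \<Rightarrow> labelling \<Rightarrow> bool" where
  "occurs D A u c g h \<longleftrightarrow>
     (let v = insert c u; xs = arranged D A u u c; ys = arranged D A u v c in
       (\<forall>C \<in> far D u c. h C = g C) \<and>
       ((card (near D u c) = 2 \<and> card (near D v c) = 1 \<and>
           h (ys ! 0) = mult (g (xs ! 0)) (g (xs ! 1))) \<or>
        (card (near D u c) = 1 \<and> card (near D v c) = 2 \<and>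
           (h (ys ! 0), h (ys ! 1)) \<in> comult (g (xs ! 0)))))"

definition edge_coeff :: "diagram \<Rightarrow> aux \<Rightarrow> vertex \<Rightarrow> nat \<Rightarrow> labelling \<Rightarrow> labelling \<Rightarrow> rat" where
  "edge_coeff D A u c g h =
     (if occurs D A u c g h then sign_P D A u c * sign_O D A u c g * sign_C D A u c g h else 0)"

definition differential :: "diagram \<Rightarrow> aux \<Rightarrow> chain \<Rightarrow> chain" where
  "differential D A x = (\<lambda>(v, h).
     if (v, h) \<in> generators D
     then \<Sum>c\<in>v. \<Sum>g\<in>labellings D (v - {c}). x (v - {c}, g) * edge_coeff D A (v - {c}) c g h
     else 0)"

definition cycles :: "diagram \<Rightarrow> aux \<Rightarrow> chain set" where
  "cycles D A = {x \<in> chains D. differential D A x = (\<lambda>_. 0)}"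

definition boundaries :: "diagram \<Rightarrow> aux \<Rightarrow> chain set" where
  "boundaries D A = differential D A ` chains D"

definition homology_class :: "diagram \<Rightarrow> aux \<Rightarrow> chain \<Rightarrow> chain set" where
  "homology_class D A z = {w \<in> cycles D A. (\<lambda>g. w g - z g) \<in> boundaries D A}"

definition filtration :: "diagram \<Rightarrow> orientation \<Rightarrow> int \<Rightarrow> chain set" where
  "filtration D \<omega> j = {x \<in> chains D. \<forall>g. x g \<noteq> 0 \<longrightarrow> j \<le> quantum_grading D \<omega> g}"

definition q_class :: "diagram \<Rightarrow> orientation \<Rightarrow> chain set \<Rightarrow> int" where
  "q_class D \<omega> Z = (GREATEST j. Z \<inter> filtration D \<omega> j \<noteq> {})"


text \<open>Lee generators.  Here \<open>\<tau>\<close> is the orientation of the oriented resolution induced by a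
  dividing circle, and \<open>\<eta>\<close> is the orientation of the link that the generator belongs to.\<close>

fun coeff_a :: "label \<Rightarrow> rat" where
  "coeff_a L1 = 1"
| "coeff_a LX = 1"

fun coeff_b :: "label \<Rightarrow> rat" where
  "coeff_b L1 = 1"
| "coeff_b LX = - 1"

definition lee_generator :: "diagram \<Rightarrow> vertex \<Rightarrow> orientation \<Rightarrow> orientation \<Rightarrow> chain" where
  "lee_generator D v \<tau> \<eta> = (\<lambda>(u, g).
     if u = v \<and> g \<in> labellings D v
     then \<Prod>C\<in>circles (resolve D v). if \<forall>p \<in> C. \<eta> p = \<tau> p then coeff_a (g C) else coeff_b (g C)
     else 0)"

definition s_invariant :: "diagram \<Rightarrow> orientation \<Rightarrow> aux \<Rightarrow> rat" where
  "s_invariant D \<omega> A =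
     (let v = oriented_vertex D \<omega>;
          x = lee_generator D v (circle_dir A v) \<omega>;
          y = lee_generator D v (circle_dir A v) (opposite \<omega>);
          qplus = q_class D \<omega> (homology_class D A (\<lambda>g. x g + y g));
          qminus = q_class D \<omega> (homology_class D A (\<lambda>g. x g - y g))
      in (of_int qplus + of_int qminus) / 2)"


text \<open>
  Dividing circles.  A crossingless diagram \<open>E\<close> is flattened to a word \<open>flatten E\<close> in
  local minima and maxima.  A curve disjoint from \<open>E\<close> is given by a crossingless word
  \<open>F\<close> and a circle \<open>C\<close> of \<open>F\<close> such that deleting \<open>C\<close> from \<open>F\<close>
  leaves \<open>flatten E\<close>; since \<open>F\<close> is arbitrary, all isotopy classes of curves disjoint
  from \<open>E\<close> arise.
\<close>

fun flatten_event :: "event \<Rightarrow> event list" where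
  "flatten_event (Vert i) = []"
| "flatten_event (Turn i) = [Cap i, Cup i]"
| "flatten_event e = [e]"

definition flatten :: "diagram \<Rightarrow> diagram" where
  "flatten E = (fst E, concat (map flatten_event (snd E)))"

definition flatten_level :: "diagram \<Rightarrow> nat \<Rightarrow> nat" where
  "flatten_level E t = length (concat (map flatten_event (take t (snd E))))"

definition flat_diagram :: "diagram \<Rightarrow> bool" where
  "flat_diagram F \<longleftrightarrow> well_formed F \<and> (\<forall>e \<in> set (snd F). \<exists>i. e = Cup i \<or> e = Cap i)"

text \<open>Deletion of a set \<open>R\<close> of points (a union of circles) from a flat diagram.\<close>

definition rank :: "point set \<Rightarrow> nat \<Rightarrow> nat \<Rightarrow> nat" where
  "rank R t k = card {k'. k' < k \<and> (t, k') \<notin> R}"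

definition delete_event :: "point set \<Rightarrow> nat \<Rightarrow> event \<Rightarrow> event list" where
  "delete_event R t e = (case e of
       Cup i \<Rightarrow> if (Suc t, i) \<in> R then [] else [Cup (rank R t i)]
     | Cap i \<Rightarrow> if (t, i) \<in> R then [] else [Cap (rank R t i)]
     | _ \<Rightarrow> [e])"

definition delete :: "point set \<Rightarrow> diagram \<Rightarrow> diagram" where
  "delete R F = (rank R 0 (fst F),
     concat (map (\<lambda>t. delete_event R t (snd F ! t)) [0..<height F]))"

definition delete_level :: "point set \<Rightarrow> diagram \<Rightarrow> nat \<Rightarrow> nat" where
  "delete_level R F t = length (concat (map (\<lambda>t. delete_event R t (snd F ! t)) [0..<t]))"

text \<open>The points of \<open>F\<close> that do not belong to \<open>E\<close>.\<close>

definition extra_points :: "diagram \<Rightarrow> point set \<Rightarrow> point set" where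
  "extra_points E C = (if \<exists>C' \<in> circles E. essential E C' then {} else C)"

definition dividing_circle :: "diagram \<Rightarrow> diagram \<Rightarrow> point set \<Rightarrow> bool" where
  "dividing_circle E F C \<longleftrightarrow>
     flat_diagram F \<and> C \<in> circles F \<and> essential F C \<and> delete (extra_points E C) F = flatten E"

text \<open>The gap \<open>(t, j)\<close> is the interval at level \<open>t\<close> between the strands \<open>j - 1\<close>
  and \<open>j\<close>.  \<open>slides e j j'\<close>: in the slab of \<open>e\<close> one can move from the gap
  \<open>j\<close> below to the gap \<open>j'\<close> above without meeting a strand.\<close>

fun slides :: "event \<Rightarrow> nat \<Rightarrow> nat \<Rightarrow> bool" where
  "slides (Cup i) j j' \<longleftrightarrow> (j \<le> i \<and> j' = j) \<or> (i \<le> j \<and> j' = j + 2)"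
| "slides (Cap i) j j' \<longleftrightarrow> (j' \<le> i \<and> j = j') \<or> (i \<le> j' \<and> j = j' + 2)"
| "slides e j j' \<longleftrightarrow> False"

text \<open>The gaps to the left and to the right of the strand through a point, as seen in the
  direction of travel.\<close>

definition left_gap :: "orientation \<Rightarrow> point \<Rightarrow> nat \<times> nat" where
  "left_gap \<tau> p = (fst p, if \<tau> p then snd p else Suc (snd p))"

definition right_gap :: "orientation \<Rightarrow> point \<Rightarrow> nat \<times> nat" where
  "right_gap \<tau> p = (fst p, if \<tau> p then Suc (snd p) else snd p)"

text \<open>
  \<open>path_to F C \<tau> x \<epsilon> S\<close>: some path in the projective plane starts on \<open>C\<close>, does not
  return to \<open>C\<close>, intersects exactly the circles in \<open>S\<close>, and ends in the gap \<open>x\<close>,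
  where the orientation of the disk complementary to \<open>C\<close> agrees with that of the page iff
  \<open>\<epsilon>\<close>.  As \<open>C\<close> carries the boundary orientation, the disk lies to the left of \<open>C\<close>
  in its own orientation.  The identification of antipodal points reverses the orientation of the
  page.
\<close>

inductive path_to ::
  "diagram \<Rightarrow> point set \<Rightarrow> orientation \<Rightarrow> nat \<times> nat \<Rightarrow> bool \<Rightarrow> point set set \<Rightarrow> bool"
  for F C \<tau> where
  start_left: "p \<in> C \<Longrightarrow> path_to F C \<tau> (left_gap \<tau> p) True {}"
| start_right: "p \<in> C \<Longrightarrow> path_to F C \<tau> (right_gap \<tau> p) False {}"
| up: "path_to F C \<tau> (t, j) \<epsilon> S \<Longrightarrow> t < height F \<Longrightarrow> j \<le> width F t \<Longrightarrow> slides (snd F ! t) j j' \<Longrightarrow>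
    path_to F C \<tau> (Suc t, j') \<epsilon> S"
| down: "path_to F C \<tau> (Suc t, j') \<epsilon> S \<Longrightarrow> t < height F \<Longrightarrow> j \<le> width F t \<Longrightarrow> slides (snd F ! t) j j' \<Longrightarrow>
    path_to F C \<tau> (t, j) \<epsilon> S"
| wrap_up: "path_to F C \<tau> (height F, j) \<epsilon> S \<Longrightarrow> j \<le> fst F \<Longrightarrow> path_to F C \<tau> (0, fst F - j) (\<not> \<epsilon>) S"
| wrap_down: "path_to F C \<tau> (0, j) \<epsilon> S \<Longrightarrow> j \<le> fst F \<Longrightarrow> path_to F C \<tau> (height F, fst F - j) (\<not> \<epsilon>) S"
| cross_right: "path_to F C \<tau> (t, k) \<epsilon> S \<Longrightarrow> (t, k) \<in> C' \<Longrightarrow> C' \<in> circles F \<Longrightarrow> C' \<noteq> C \<Longrightarrow>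
    path_to F C \<tau> (t, Suc k) \<epsilon> (insert C' S)"
| cross_left: "path_to F C \<tau> (t, Suc k) \<epsilon> S \<Longrightarrow> (t, k) \<in> C' \<Longrightarrow> C' \<in> circles F \<Longrightarrow> C' \<noteq> C \<Longrightarrow>
    path_to F C \<tau> (t, k) \<epsilon> (insert C' S)"

definition distance :: "diagram \<Rightarrow> point set \<Rightarrow> orientation \<Rightarrow> point set \<Rightarrow> nat" where
  "distance F C \<tau> C' = 1 + (LEAST d. \<exists>p \<epsilon> S. p \<in> C' \<and> C' \<notin> S \<and> card S = d \<and>
     (path_to F C \<tau> (left_gap \<tau> p) \<epsilon> S \<or> path_to F C \<tau> (right_gap \<tau> p) \<epsilon> S))"

text \<open>A circle is counterclockwise iff its outside, the side reached from \<open>C\<close> without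
  crossing the circle, lies on its right with respect to the orientation of the disk.\<close>

definition counterclockwise :: "diagram \<Rightarrow> point set \<Rightarrow> orientation \<Rightarrow> point set \<Rightarrow> bool" where
  "counterclockwise F C \<tau> C' \<longleftrightarrow> (\<exists>p S. p \<in> C' \<and> C' \<notin> S \<and>
     (path_to F C \<tau> (right_gap \<tau> p) True S \<or> path_to F C \<tau> (left_gap \<tau> p) False S))"

text \<open>\<open>\<tau>\<close> is the orientation induced by the dividing circle \<open>C\<close>, where \<open>C\<close> itself is
  oriented by the restriction of \<open>\<tau>\<close>.\<close>

definition dividing_orientation :: "diagram \<Rightarrow> point set \<Rightarrow> orientation \<Rightarrow> bool" where
  "dividing_orientation F C \<tau> \<longleftrightarrow> orients \<tau> F \<and>
     (\<forall>C' \<in> circles F - {C}. counterclockwise F C \<tau> C' \<longleftrightarrow> even (distance F C \<tau> C'))"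

text \<open>Equality of the orientation \<open>\<rho>\<close> of \<open>E\<close> and the orientation \<open>\<tau>\<close> of the
  copy of \<open>E\<close> inside \<open>F\<close>.\<close>

definition restricts_to :: "diagram \<Rightarrow> point set \<Rightarrow> orientation \<Rightarrow> diagram \<Rightarrow> orientation \<Rightarrow> bool" where
  "restricts_to F C \<tau> E \<rho> \<longleftrightarrow>
     (let R = extra_points E C in
      \<forall>(t, k) \<in> points E. \<forall>(t', k') \<in> points F - R.
        flatten_level E t = delete_level R F t' \<and> k = rank R t' k' \<longrightarrow> \<rho> (t, k) = \<tau> (t', k'))"

text \<open>The choices that enter the definition of the s-invariant from the oriented diagram
  \<open>(D, \<omega>)\<close>: local orientations are induced by \<open>\<omega>\<close>, and the circles of the oriented
  resolution are oriented by some dividing circle.\<close>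

definition lee_choices :: "diagram \<Rightarrow> orientation \<Rightarrow> aux \<Rightarrow> bool" where
  "lee_choices D \<omega> A \<longleftrightarrow>
     auxiliary_choices D A \<and>
     (\<forall>c \<in> crossings D. strands_up A c = (\<omega> (page_sw D c), \<omega> (page_se D c))) \<and>
     (\<exists>F C \<tau>. dividing_circle (oriented_resolution D \<omega>) F C \<and> dividing_orientation F C \<tau> \<and>
        restricts_to F C \<tau> (oriented_resolution D \<omega>) (circle_dir A (oriented_vertex D \<omega>)))"

end

theory Submission
  imports Defs
begin

text \<open>
  In a positive diagram the oriented resolution is the vertex \<open>{}\<close> of the cube, in which no edge
  ends.  Hence all representatives of a class of a cycle over \<open>{}\<close> agree there, and \<open>q\<close> is the
  minimal grading of a generator occurring in the cycle.  With \<open>r\<close> circles, the Lee generators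
  are \<open>\<Otimes>(1 + \<epsilon> X)\<close> and \<open>\<Otimes>(1 - \<epsilon> X)\<close> with signs \<open>\<epsilon>\<close>, so their sum and difference consist of the
  labellings with an even, resp. odd, number of \<open>X\<close>.  The two minimal gradings are therefore
  \<open>n - r\<close> and \<open>n - r + 2\<close>, in some order.

  That the Lee generators are cycles does not depend on how the circles are oriented.  An edge out
  of \<open>{}\<close> is never a 1-2 bifurcation, because the other resolution of a crossing does not respect
  the orientation; and in a 2-1 bifurcation the signs turn the two labels into \<open>a\<close> and \<open>b\<close>, whose
  product is zero.
\<close>

section \<open>Resolved diagrams and their points\<close>

lemma height_resolve [simp]: "height (resolve D v) = height D"
  by (simp add: height_def resolve_def)

lemma fst_resolve [simp]: "fst (resolve D v) = fst D"
  by (simp add: resolve_def)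

lemma nth_resolve: "t < height D \<Longrightarrow> snd (resolve D v) ! t = smoothing (t \<in> v) (snd D ! t)"
  by (simp add: resolve_def)

lemma width_above_smoothing [simp]: "width_above (smoothing b e) = width_above e"
  by (cases e) auto

lemma fits_smoothing [simp]: "fits (smoothing b e) w = fits e w"
  by (cases e) auto

lemma width_resolve [simp]: "width (resolve D v) t = width D t"
proof -
  \<comment> \<open>The event list is rewritten as a map over its indices, the form in which
    \<open>resolve\<close> builds its own list.\<close>
  have "width D t = fold width_above (take t (map ((!) (snd D)) [0..<height D])) (fst D)"
    by (simp add: width_def height_def map_nth)
  then show ?thesis
    by (simp add: width_def resolve_def take_map fold_map comp_def)
qed

lemma well_formed_resolve [simp]: "well_formed (resolve D v) = well_formed D"
  by (auto simp: well_formed_def nth_resolve)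

lemma points_resolve [simp]: "points (resolve D v) = points D"
  by (simp add: points_def)

lemma width_0 [simp]: "width D 0 = fst D"
  by (simp add: width_def)

lemma width_Suc: "t < height D \<Longrightarrow> width D (Suc t) = width_above (snd D ! t) (width D t)"
  by (simp add: width_def height_def take_Suc_conv_app_nth)

lemma well_formed_fits: "well_formed D \<Longrightarrow> t < height D \<Longrightarrow> fits (snd D ! t) (width D t)"
  by (simp add: well_formed_def)

lemma well_formed_width_height: "well_formed D \<Longrightarrow> width D (height D) = fst D"
  by (simp add: well_formed_def)

lemma finite_points: "finite (points D)"
proof -
  have "points D = (SIGMA t:{..height D}. {..<width D t})"
    by (auto simp: points_def)
  then show ?thesis by simp
qed

lemma passes_bounds:
  "fits e w \<Longrightarrow> k < w \<Longrightarrow> passes e k k' \<Longrightarrow> k' < width_above e w"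
  by (cases e) (auto simp: transpose_def split: if_splits)

lemma maxima_bounds: "fits e w \<Longrightarrow> i \<in> maxima e \<Longrightarrow> i + 1 < w"
  by (cases e) auto

lemma minima_bounds: "fits e w \<Longrightarrow> i \<in> minima e \<Longrightarrow> i + 1 < width_above e w"
  by (cases e) auto

lemma straight_points:
  assumes "well_formed E" "straight E p q"
  shows "p \<in> points E \<and> q \<in> points E"
  using assms(2)
proof cases
  case (through t k k')
  then show ?thesis
    using passes_bounds[OF well_formed_fits[OF assms(1)]]
    by (auto simp: points_def width_Suc)
next
  case (antipodal k)
  then show ?thesis
    using assms(1) by (simp add: points_def well_formed_width_height)
qed

lemma turning_points:
  assumes "well_formed E" "turning E p q"
  shows "p \<in> points E \<and> q \<in> points E"
  using assms(2)
proof cases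
  case (minimum t i)
  then have "i + 1 < width_above (snd E ! t) (width E t)"
    using minima_bounds well_formed_fits assms(1) by blast
  then show ?thesis using minimum by (simp add: points_def width_Suc)
next
  case (maximum t i)
  then have "i + 1 < width E t"
    using maxima_bounds well_formed_fits assms(1) by blast
  then show ?thesis using maximum by (simp add: points_def)
qed

lemma joined_points:
  assumes "well_formed E" "joined E p q"
  shows "p \<in> points E \<and> q \<in> points E"
  using assms straight_points turning_points unfolding joined_def by blast

lemma equivclp_joined_points:
  assumes "well_formed E" "equivclp (joined E) p q" "p \<in> points E"
  shows "q \<in> points E"
  using assms(2,3)
  by (induction rule: equivclp_induct) (use assms(1) joined_points in blast)+

lemma equivclp_step: "r x y \<or> r y x \<Longrightarrow> equivclp r x y"
  by (metis r_into_equivclp equivclp_sym)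

section \<open>Circles\<close>

lemma finite_circles: "finite (circles E)"
proof -
  have "circles E = (\<lambda>p. {q. equivclp (joined E) p q}) ` points E"
    by (auto simp: circles_def)
  then show ?thesis by (simp add: finite_points)
qed

definition circle_of :: "diagram \<Rightarrow> point \<Rightarrow> point set" where
  "circle_of E p = {q. equivclp (joined E) p q}"

lemma circle_of_self [simp]: "p \<in> circle_of E p"
  by (simp add: circle_of_def)

lemma circle_of_circles: "p \<in> points E \<Longrightarrow> circle_of E p \<in> circles E"
  unfolding circle_of_def circles_def by blast

lemma circle_of_eq: "equivclp (joined E) p q \<Longrightarrow> circle_of E p = circle_of E q"
  unfolding circle_of_def by (blast intro: equivclp_sym equivclp_trans)

lemma circles_unique: "C \<in> circles E \<Longrightarrow> p \<in> C \<Longrightarrow> C = circle_of E p"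
proof -
  assume "C \<in> circles E" "p \<in> C"
  then obtain q where "C = circle_of E q" "equivclp (joined E) q p"
    unfolding circles_def circle_of_def by blast
  then show ?thesis using circle_of_eq by metis
qed

text \<open>Both orientations are kept along straight arcs and reversed at turns, so whether they
  agree cannot change along a circle.\<close>

lemma orientations_on_circle:
  assumes "orients \<eta> E" "orients \<tau> E" "C \<in> circles E" "p \<in> C"
  shows "(\<forall>q\<in>C. \<eta> q = \<tau> q) \<longleftrightarrow> \<eta> p = \<tau> p"
proof -
  have "(\<eta> q = \<tau> q) = (\<eta> p = \<tau> p)" if "equivclp (joined E) p q" for q
    using that
  proof (induction rule: equivclp_induct)
    case base
    then show ?case by simp
  next
    case (step y z)
    then show ?case using assms(1,2) unfolding orients_def joined_def by metis
  qed
  moreover have "C = circle_of E p" using assms circles_unique by blast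
  ultimately have "(\<eta> q = \<tau> q) = (\<eta> p = \<tau> p)" if "q \<in> C" for q
    using that unfolding circle_of_def by blast
  then show ?thesis using assms(4) by blast
qed

section \<open>The successor of a point in direction of travel\<close>

definition max_pair :: "diagram \<Rightarrow> point \<Rightarrow> point \<Rightarrow> bool" where
  "max_pair E p q \<longleftrightarrow> (\<exists>t i. t < height E \<and> i \<in> maxima (snd E ! t) \<and>
     (p = (t, i) \<and> q = (t, i + 1) \<or> p = (t, i + 1) \<and> q = (t, i)))"

definition min_pair :: "diagram \<Rightarrow> point \<Rightarrow> point \<Rightarrow> bool" where
  "min_pair E p q \<longleftrightarrow> (\<exists>t i. t < height E \<and> i \<in> minima (snd E ! t) \<and>
     (p = (Suc t, i) \<and> q = (Suc t, i + 1) \<or> p = (Suc t, i + 1) \<and> q = (Suc t, i)))"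

text \<open>The neighbour of \<open>p\<close> along the arc above \<open>p\<close>; at the top level
  this is the antipode on the bottom side.\<close>

definition upper :: "diagram \<Rightarrow> point \<Rightarrow> point \<Rightarrow> bool" where
  "upper E p q \<longleftrightarrow> straight E p q \<or> max_pair E p q"

definition lower :: "diagram \<Rightarrow> point \<Rightarrow> point \<Rightarrow> bool" where
  "lower E p q \<longleftrightarrow> straight E q p \<or> min_pair E p q"

definition successor :: "diagram \<Rightarrow> orientation \<Rightarrow> point \<Rightarrow> point \<Rightarrow> bool" where
  "successor E \<omega> p q \<longleftrightarrow> (if \<omega> p then upper E p q else lower E p q)"

lemma turning_iff: "turning E p q \<or> turning E q p \<longleftrightarrow> max_pair E p q \<or> min_pair E p q"
  unfolding max_pair_def min_pair_def turning.simps by blast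

lemma successor_joined: "successor E \<omega> p q \<Longrightarrow> joined E p q \<or> joined E q p"
  using turning_iff[of E p q]
  unfolding successor_def upper_def lower_def joined_def by (auto split: if_splits)

lemma passes_or_maximum:
  assumes "fits e w" "k < w"
  shows "(\<exists>k'. passes e k k') \<or> (\<exists>i\<in>maxima e. k = i \<or> k = i + 1)"
proof (cases e)
  case (Cup i)
  then show ?thesis by (cases "k < i") auto
next
  case (Cap i)
  have "k < i \<or> k = i \<or> k = i + 1 \<or> (\<exists>k'. k = k' + 2 \<and> i \<le> k')"
    by presburger
  then show ?thesis using Cap by auto
qed auto

lemma passes_or_minimum:
  assumes "fits e w" "k' < width_above e w"
  shows "(\<exists>k<w. passes e k k') \<or> (\<exists>i\<in>minima e. k' = i \<or> k' = i + 1)"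
proof (cases e)
  case (Cup i)
  have "k' < i \<or> k' = i \<or> k' = i + 1 \<or> (\<exists>k. k' = k + 2 \<and> i \<le> k)"
    by presburger
  then show ?thesis using Cup assms by auto
next
  case (Cap i)
  then show ?thesis using assms by (cases "k' < i") auto
next
  case (Cross b i)
  \<comment> \<open>A transposition is its own inverse, so it also yields the preimage of
    \<open>k'\<close>.\<close>
  then have "transpose i (i + 1) k' < w" using assms by (auto simp: transpose_def)
  then show ?thesis using Cross by (intro disjI1 exI[of _ "transpose i (i + 1) k'"]) auto
next
  case (Vert i)
  then show ?thesis using assms by auto
next
  case (Turn i)
  then show ?thesis using assms by auto
qed

lemma passes_fun: "passes e k k' \<Longrightarrow> passes e k k'' \<Longrightarrow> k' = k''"
  by (cases e) auto

lemma passes_inj: "passes e k l \<Longrightarrow> passes e k' l \<Longrightarrow> k = k'"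
  by (cases e) (auto dest: injD[OF inj_transpose])

lemma passes_not_maximum: "passes e k k' \<Longrightarrow> i \<in> maxima e \<Longrightarrow> k \<noteq> i \<and> k \<noteq> Suc i"
  by (cases e) auto

lemma passes_not_minimum: "passes e k k' \<Longrightarrow> i \<in> minima e \<Longrightarrow> k' \<noteq> i \<and> k' \<noteq> Suc i"
  by (cases e) auto

lemma maxima_unique: "i \<in> maxima e \<Longrightarrow> j \<in> maxima e \<Longrightarrow> i = j"
  by (cases e) auto

lemma minima_unique: "i \<in> minima e \<Longrightarrow> j \<in> minima e \<Longrightarrow> i = j"
  by (cases e) auto

lemma upper_exists:
  assumes "well_formed E" "p \<in> points E"
  shows "\<exists>q. upper E p q"
proof -
  obtain t k where p: "p = (t, k)" "t \<le> height E" "k < width E t"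
    using assms(2) by (auto simp: points_def)
  show ?thesis
  proof (cases "t < height E")
    case True
    have "(\<exists>k'. passes (snd E ! t) k k') \<or> (\<exists>i\<in>maxima (snd E ! t). k = i \<or> k = i + 1)"
      using passes_or_maximum well_formed_fits assms(1) True p(3) by blast
    then show ?thesis
    proof
      assume "\<exists>k'. passes (snd E ! t) k k'"
      then show ?thesis using True p unfolding upper_def by (blast intro: straight.through)
    next
      assume "\<exists>i\<in>maxima (snd E ! t). k = i \<or> k = i + 1"
      then show ?thesis using True p unfolding upper_def max_pair_def by blast
    qed
  next
    case False
    then have "straight E p (0, fst E - 1 - k)"
      using p assms(1) straight.antipodal[of k E] by (simp add: well_formed_width_height)
    then show ?thesis by (auto simp: upper_def)
  qed
qed

lemma lower_exists:
  assumes "well_formed E" "p \<in> points E"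
  shows "\<exists>q. lower E p q"
proof -
  obtain t' k where p: "p = (t', k)" "t' \<le> height E" "k < width E t'"
    using assms(2) by (auto simp: points_def)
  show ?thesis
  proof (cases t')
    case (Suc t)
    then have t: "t < height E" using p by simp
    have "(\<exists>k'<width E t. passes (snd E ! t) k' k) \<or>
        (\<exists>i\<in>minima (snd E ! t). k = i \<or> k = i + 1)"
      using passes_or_minimum[OF well_formed_fits[OF assms(1) t]] p(3) Suc t
      by (simp add: width_Suc)
    then show ?thesis
    proof
      assume "\<exists>k'<width E t. passes (snd E ! t) k' k"
      then show ?thesis using t p Suc unfolding lower_def by (blast intro: straight.through)
    next
      assume "\<exists>i\<in>minima (snd E ! t). k = i \<or> k = i + 1"
      then show ?thesis using t p Suc unfolding lower_def min_pair_def by blast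
    qed
  next
    case 0
    then have "k < fst E" using p by simp
    \<comment> \<open>The antipodal map is an involution on positions; \<open>k < fst E\<close>
      keeps the truncated subtraction honest.\<close>
    then have "fst E - 1 - (fst E - 1 - k) = k" "fst E - 1 - k < fst E" by auto
    then have "straight E (height E, fst E - 1 - k) (0, k)"
      using straight.antipodal by metis
    then show ?thesis using p 0 unfolding lower_def by blast
  qed
qed

text \<open>The event above a point either lets its strand pass, to one position only, or turns it
  at its only maximum, never both; the top level has only the antipodal arc.\<close>

lemma upper_unique:
  assumes "upper E p q" "upper E p q'"
  shows "q = q'"
  using assms unfolding upper_def max_pair_def straight.simps
  by (elim disjE exE conjE)
    (auto dest: passes_fun passes_not_maximum maxima_unique)

lemma lower_unique:
  assumes "lower E p q" "lower E p q'"
  shows "q = q'"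
  using assms unfolding lower_def min_pair_def straight.simps
  by (elim disjE exE conjE)
    (auto dest: passes_inj passes_not_minimum minima_unique)

lemma orients_straight: "orients \<omega> E \<Longrightarrow> straight E p q \<Longrightarrow> \<omega> p = \<omega> q"
  unfolding orients_def by blast

lemma orients_pair:
  "orients \<omega> E \<Longrightarrow> max_pair E p q \<or> min_pair E p q \<Longrightarrow> \<omega> p \<noteq> \<omega> q"
  unfolding turning_iff[symmetric] orients_def by blast

lemma pair_sym:
  "max_pair E p q = max_pair E q p" "min_pair E p q = min_pair E q p"
  unfolding max_pair_def min_pair_def by blast+

lemma successor_exists: "well_formed E \<Longrightarrow> p \<in> points E \<Longrightarrow> \<exists>q. successor E \<omega> p q"
  unfolding successor_def using upper_exists lower_exists by metis

lemma successor_injective: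
  assumes "orients \<omega> E" "successor E \<omega> p q" "successor E \<omega> p' q"
  shows "p = p'"
proof -
  \<comment> \<open>A predecessor lies behind \<open>q\<close>: a straight arc keeps the direction,
    and a turn reverses it while staying on the same side, so the direction at \<open>q\<close>
    alone tells on which side \<open>x\<close> lies.\<close>
  have "if \<omega> q then lower E q x else upper E q x" if "successor E \<omega> x q" for x
    using that orients_straight[OF assms(1), of x q] orients_straight[OF assms(1), of q x]
      orients_pair[OF assms(1), of x q]
    unfolding successor_def upper_def lower_def by (auto simp: pair_sym split: if_splits)
  then show ?thesis
    using assms(2,3) upper_unique lower_unique by (metis (full_types))
qed

text \<open>The successor map is injective on the finite set \<open>C\<close>, so it cannot map \<open>C\<close> into
  itself when it also hits \<open>C\<close> from outside.\<close>

lemma successor_leaves: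
  assumes "well_formed E" "orients \<omega> E" "C \<subseteq> points E"
    and "successor E \<omega> p q" "p \<notin> C" "q \<in> C"
  obtains x y where "x \<in> C" "successor E \<omega> x y" "y \<notin> C"
proof -
  define f where "f x = (SOME y. successor E \<omega> x y)" for x
  have f: "successor E \<omega> x (f x)" if "x \<in> C" for x
    using successor_exists[OF assms(1)] that assms(3) unfolding f_def by (blast intro: someI_ex)
  have "inj_on f C"
  proof (rule inj_onI)
    fix x y assume "x \<in> C" "y \<in> C" "f x = f y"
    then show "x = y" using f[of x] f[of y] successor_injective[OF assms(2)] by simp
  qed
  have "\<not> f ` C \<subseteq> C"
  proof
    assume "f ` C \<subseteq> C"
    then have "f ` C = C"
      using endo_inj_surj[OF finite_subset[OF assms(3) finite_points]] \<open>inj_on f C\<close> by simp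
    then have "q \<in> f ` C" using assms(6) by simp
    then obtain x where "x \<in> C" "f x = q" by blast
    then have "x = p" using f[of x] successor_injective[OF assms(2) _ assms(4)] by simp
    then show False using \<open>x \<in> C\<close> assms(5) by simp
  qed
  then obtain x where "x \<in> C" "f x \<notin> C" by blast
  then show ?thesis using f[of x] that by blast
qed

section \<open>Changing the resolution of one crossing\<close>

text \<open>The two resolutions differ only in the slab of \<open>c\<close>, so the arc above
  \<open>p\<close> can be lost only when \<open>p\<close> is one of the two lower corners.\<close>

lemma upper_resolve_insert:
  assumes "snd D ! c = Cross b i" "upper (resolve D u) p q"
  shows "upper (resolve D (insert c u)) p q \<or> p \<in> corners D c \<and> fst p = c"
  using assms(2) unfolding upper_def
proof
  assume "straight (resolve D u) p q"
  then show "(straight (resolve D (insert c u)) p q \<or> max_pair (resolve D (insert c u)) p q) \<or>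
      p \<in> corners D c \<and> fst p = c"
  proof cases
    case (through t k k')
    show ?thesis
    proof (cases "t = c \<and> (k = i \<or> k = i + 1)")
      case True
      then show ?thesis using through assms(1) by (auto simp: corners_def page_sw_def page_se_def)
    next
      case False
      then have "passes (snd (resolve D (insert c u)) ! t) k k'"
        using through assms(1) by (cases "t = c") (auto simp: nth_resolve split: if_splits)
      then show ?thesis using through by (auto intro: straight.through)
    qed
  next
    case (antipodal k)
    then show ?thesis using straight.antipodal[of k "resolve D (insert c u)"] by simp
  qed
next
  assume "max_pair (resolve D u) p q"
  then obtain t j where t: "t < height D" "j \<in> maxima (snd (resolve D u) ! t)"
    "p = (t, j) \<and> q = (t, j + 1) \<or> p = (t, j + 1) \<and> q = (t, j)"
    unfolding max_pair_def by auto
  show "(straight (resolve D (insert c u)) p q \<or> max_pair (resolve D (insert c u)) p q) \<or>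
      p \<in> corners D c \<and> fst p = c"
  proof (cases "t = c")
    case True
    then have "j = i" using t assms(1) by (auto simp: nth_resolve split: if_splits)
    then show ?thesis using t True assms(1) by (auto simp: corners_def page_sw_def page_se_def)
  next
    case False
    then show ?thesis using t unfolding max_pair_def by (auto simp: nth_resolve)
  qed
qed

lemma lower_resolve_insert:
  assumes "snd D ! c = Cross b i" "lower (resolve D u) p q"
  shows "lower (resolve D (insert c u)) p q \<or> p \<in> corners D c \<and> fst p = Suc c"
  using assms(2) unfolding lower_def
proof
  assume "straight (resolve D u) q p"
  then show "(straight (resolve D (insert c u)) q p \<or> min_pair (resolve D (insert c u)) p q) \<or>
      p \<in> corners D c \<and> fst p = Suc c"
  proof cases
    case (through t k k')
    show ?thesis
    proof (cases "t = c \<and> (k = i \<or> k = i + 1)")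
      case True
      then show ?thesis using through assms(1)
        by (auto simp: nth_resolve corners_def page_nw_def page_ne_def split: if_splits)
    next
      case False
      then have "passes (snd (resolve D (insert c u)) ! t) k k'"
        using through assms(1) by (cases "t = c") (auto simp: nth_resolve split: if_splits)
      then show ?thesis using through by (auto intro: straight.through)
    qed
  next
    case (antipodal k)
    then show ?thesis using straight.antipodal[of k "resolve D (insert c u)"] by simp
  qed
next
  assume "min_pair (resolve D u) p q"
  then obtain t j where t: "t < height D" "j \<in> minima (snd (resolve D u) ! t)"
    "p = (Suc t, j) \<and> q = (Suc t, j + 1) \<or> p = (Suc t, j + 1) \<and> q = (Suc t, j)"
    unfolding min_pair_def by auto
  show "(straight (resolve D (insert c u)) q p \<or> min_pair (resolve D (insert c u)) p q) \<or>
      p \<in> corners D c \<and> fst p = Suc c"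
  proof (cases "t = c")
    case True
    then have "j = i" using t assms(1) by (auto simp: nth_resolve split: if_splits)
    then show ?thesis using t True assms(1) by (auto simp: corners_def page_nw_def page_ne_def)
  next
    case False
    then show ?thesis using t unfolding min_pair_def by (auto simp: nth_resolve)
  qed
qed

lemma resolve_vert:
  assumes "c < height D" "i + 2 \<le> width D c" "snd (resolve D v) ! c = Vert i"
  shows "straight (resolve D v) (c, i) (Suc c, i)"
    and "straight (resolve D v) (c, i + 1) (Suc c, i + 1)"
  using assms straight.through[of c "resolve D v" i i]
    straight.through[of c "resolve D v" "i + 1" "i + 1"] by simp_all

lemma resolve_turn:
  assumes "c < height D" "snd (resolve D v) ! c = Turn i"
  shows "max_pair (resolve D v) (c, i) (c, i + 1)"
    and "min_pair (resolve D v) (Suc c, i) (Suc c, i + 1)"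
  using assms unfolding max_pair_def min_pair_def by auto

text \<open>Counting near circles thus amounts to deciding which of the four corners are
  connected.\<close>

lemma near_eq:
  assumes "corners D c \<subseteq> points D"
  shows "near D v c = circle_of (resolve D v) ` corners D c"
proof -
  have "C \<in> circle_of (resolve D v) ` corners D c"
    if "C \<in> circles (resolve D v)" "C \<inter> corners D c \<noteq> {}" for C
    using that circles_unique by blast
  moreover have "circle_of (resolve D v) p \<in> near D v c" if "p \<in> corners D c" for p
    using that assms circle_of_circles[of p "resolve D v"] circle_of_self[of p "resolve D v"]
    unfolding near_def points_resolve by blast
  ultimately show ?thesis unfolding near_def by auto
qed

text \<open>In compass directions the strands enter the crossing at SW and SE and leave it at NW and
  NE.\<close>

definition corner_SE :: "diagram \<Rightarrow> aux \<Rightarrow> nat \<Rightarrow> point" where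
  "corner_SE D A c = (case compass D A c of (sw, se, ne, nw) \<Rightarrow> se)"

lemmas page_defs = page_sw_def page_se_def page_ne_def page_nw_def
lemmas corner_defs = corner_SW_def corner_SE_def corner_NE_def corner_NW_def

lemma corners_compass:
  "corners D c = {corner_SW D A c, corner_SE D A c, corner_NE D A c, corner_NW D A c}"
  by (cases "strands_up A c"; cases "fst (strands_up A c)"; cases "snd (strands_up A c)")
    (auto simp: corners_def corner_defs compass_def Let_def)

section \<open>Chains\<close>

fun swap_label :: "label \<Rightarrow> label" where
  "swap_label L1 = LX"
| "swap_label LX = L1"

text \<open>The involution on labellings that later pairs off the summands of the
  differential.\<close>

definition flip :: "point set set \<Rightarrow> labelling \<Rightarrow> labelling" where
  "flip S g = (\<lambda>C. if C \<in> S then swap_label (g C) else g C)"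

lemma swap_label_eq_iff [simp]: "swap_label x = LX \<longleftrightarrow> x \<noteq> LX"
  by (cases x) auto

lemma swap_swap_label [simp]: "swap_label (swap_label x) = x"
  by (cases x) auto

lemma flip_flip [simp]: "flip S (flip S g) = g"
  by (auto simp: flip_def)

lemma flip_labellings:
  "S \<subseteq> circles (resolve D v) \<Longrightarrow> g \<in> labellings D v \<Longrightarrow> flip S g \<in> labellings D v"
  by (auto simp: flip_def labellings_def PiE_iff extensional_def)

text \<open>Swapping a label is multiplication by X, and the square of X is 1.\<close>

lemma mult_swap_label: "mult (swap_label x) (swap_label y) = mult x y"
  by (cases x; cases y) auto

text \<open>The coefficient of \<open>g\<close> in the tensor product of the factors 1 +
  \<open>\<delta> C\<close> X over the circles \<open>C\<close> in \<open>S\<close>.\<close>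

definition label_sign :: "point set set \<Rightarrow> (point set \<Rightarrow> rat) \<Rightarrow> labelling \<Rightarrow> rat" where
  "label_sign S \<delta> g = (\<Prod>C\<in>S. if g C = LX then \<delta> C else 1)"

text \<open>As \<open>\<delta> C\<close> is its own inverse, changing the label of \<open>C\<close>
  in either direction multiplies the coefficient by \<open>\<delta> C\<close>.\<close>

lemma label_sign_flip:
  assumes "finite S" "W \<in> S" "V \<in> S" "W \<noteq> V" "\<delta> W * \<delta> W = 1" "\<delta> V * \<delta> V = 1"
  shows "label_sign S \<delta> (flip {W, V} g) = \<delta> W * \<delta> V * label_sign S \<delta> g"
proof -
  define R where "R = S - {W, V}"
  have S: "S = insert W (insert V R)" "W \<notin> insert V R" "V \<notin> R" "finite R"
    using assms by (auto simp: R_def)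
  have "(\<Prod>C\<in>R. if flip {W, V} g C = LX then \<delta> C else 1) = (\<Prod>C\<in>R. if g C = LX then \<delta> C else 1)"
    using S by (intro prod.cong) (auto simp: flip_def)
  then show ?thesis
    using S assms(4-6) by (simp add: label_sign_def flip_def) (auto simp: algebra_simps)
qed

lemma neg_one_power_card:
  "finite S \<Longrightarrow> (- 1) ^ card {C \<in> S. P C} = (\<Prod>C\<in>S. if P C then - 1 else 1 :: rat)"
  by (simp add: prod.If_cases Int_def)

lemma lee_generator_eq:
  assumes "g \<in> labellings D v"
  shows "lee_generator D v \<tau> \<eta> (v, g) =
    label_sign (circles (resolve D v)) (\<lambda>C. if \<forall>p\<in>C. \<eta> p = \<tau> p then 1 else - 1) g"
proof -
  have *: "coeff_a l = 1" "coeff_b l = (if l = LX then - 1 else 1)" for l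
    by (cases l; simp)+
  show ?thesis unfolding lee_generator_def label_sign_def using assms
    by (auto simp: * intro!: prod.cong)
qed

section \<open>The differential and the filtration for chains over the vertex
  \<open>{}\<close>\<close>

lemma differential_origin: "differential D A x ({}, g) = 0"
  by (simp add: differential_def)

lemma differential_0: "differential D A (\<lambda>_. 0) = (\<lambda>_. 0)"
  by (auto simp: differential_def)

text \<open>For a chain over \<open>{}\<close> only the edges from \<open>{}\<close> to
  \<open>{c}\<close> contribute, one for each crossing.\<close>

lemma differential_eq_0:
  assumes "\<And>v g. v \<noteq> {} \<Longrightarrow> z (v, g) = 0"
    and "\<And>c h. c \<in> crossings D \<Longrightarrow> (\<Sum>g\<in>labellings D {}. z ({}, g) * edge_coeff D A {} c g h) = 0"
  shows "differential D A z = (\<lambda>_. 0)"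
proof -
  have "(\<Sum>c\<in>v. \<Sum>g\<in>labellings D (v - {c}). z (v - {c}, g) * edge_coeff D A (v - {c}) c g h) = 0"
    if "v \<subseteq> crossings D" for v h
  proof (rule sum.neutral, rule ballI)
    fix c assume "c \<in> v"
    show "(\<Sum>g\<in>labellings D (v - {c}). z (v - {c}, g) * edge_coeff D A (v - {c}) c g h) = 0"
    proof (cases "v - {c} = {}")
      case True
      then show ?thesis unfolding True using assms(2) \<open>c \<in> v\<close> that by blast
    next
      case False
      then show ?thesis using assms(1) by simp
    qed
  qed
  then show ?thesis by (auto simp: differential_def generators_def)
qed

text \<open>No edge of the cube ends in the vertex \<open>{}\<close>, so adding boundaries does not change the
  values there.\<close>

lemma q_class_origin:
  assumes "z \<in> cycles D A" "\<And>v g. z (v, g) \<noteq> 0 \<Longrightarrow> v = {}"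
    and "z ({}, g) \<noteq> 0"
    and "\<And>g'. z ({}, g') \<noteq> 0 \<Longrightarrow> quantum_grading D \<omega> ({}, g) \<le> quantum_grading D \<omega> ({}, g')"
  shows "q_class D \<omega> (homology_class D A z) = quantum_grading D \<omega> ({}, g)"
  unfolding q_class_def
proof (rule Greatest_equality)
  \<comment> \<open>The zero boundary makes \<open>z\<close> a representative of its own
    class.\<close>
  have "(\<lambda>_. 0) \<in> boundaries D A"
    unfolding boundaries_def using differential_0[of D A]
    by (intro image_eqI[of _ _ "\<lambda>_. 0"]) (auto simp: chains_def)
  then have "z \<in> homology_class D A z"
    using assms(1) by (simp add: homology_class_def)
  moreover have "z \<in> filtration D \<omega> (quantum_grading D \<omega> ({}, g))"
    using assms(1,2,4) by (fastforce simp: filtration_def cycles_def)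
  ultimately show "homology_class D A z \<inter> filtration D \<omega> (quantum_grading D \<omega> ({}, g)) \<noteq> {}"
    by blast
next
  fix j assume "homology_class D A z \<inter> filtration D \<omega> j \<noteq> {}"
  then obtain w where w: "w \<in> homology_class D A z" "w \<in> filtration D \<omega> j" by blast
  then obtain x where "(\<lambda>g. w g - z g) = differential D A x"
    by (auto simp: homology_class_def boundaries_def)
  then have "w ({}, g) - z ({}, g) = 0" using differential_origin[of D A x g] by metis
  then show "j \<le> quantum_grading D \<omega> ({}, g)"
    using w(2) assms(3) by (auto simp: filtration_def)
qed

lemma filter_singleton:
  assumes "distinct xs" "{x \<in> set xs. P x} = {a}"
  shows "filter P xs = [a]"
proof -
  have "card (set (filter P xs)) = 1" using assms(2) by simp
  then have "length (filter P xs) = 1" using assms(1) distinct_card distinct_filter by metis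
  then obtain b where "filter P xs = [b]" by (metis One_nat_def length_0_conv length_Suc_conv)
  moreover have "set (filter P xs) = {a}" using assms(2) by simp
  ultimately show ?thesis by simp
qed

section \<open>Positive diagrams\<close>

locale positive_choices =
  fixes D :: diagram and \<omega> :: orientation and A :: aux
  assumes diagram: "well_formed D"
    and oriented: "orients \<omega> D"
    and positive: "positive_diagram D \<omega>"
    and choices: "auxiliary_choices D A"
    and local_orientation:
      "c \<in> crossings D \<Longrightarrow> strands_up A c = (\<omega> (page_sw D c), \<omega> (page_se D c))"
begin

text \<open>Positivity enters here: it ties the kind \<open>b\<close> of the crossing to the
  directions of its strands, and these directions are kept on passing through the crossing.\<close>

lemma crossing:
  assumes "c \<in> crossings D"
  obtains b i where "snd D ! c = Cross b i" "c < height D" "i + 2 \<le> width D c"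
    "b = (\<omega> (c, i) = \<omega> (c, i + 1))" "\<omega> (Suc c, i + 1) = \<omega> (c, i)" "\<omega> (Suc c, i) = \<omega> (c, i + 1)"
proof -
  obtain b i where b: "snd D ! c = Cross b i" "c < height D"
    using assms by (auto simp: crossings_def)
  have i: "i + 2 \<le> width D c"
    using well_formed_fits[OF diagram b(2)] b(1) by simp
  have "b = (\<omega> (c, i) = \<omega> (c, i + 1))"
    using positive assms b by (auto simp: positive_diagram_def positive_crossing_def page_defs)
  moreover have "straight D (c, i) (Suc c, i + 1)" "straight D (c, i + 1) (Suc c, i)"
    using b i straight.through[of c D i "i + 1"] straight.through[of c D "i + 1" i] by simp_all
  then have "\<omega> (Suc c, i + 1) = \<omega> (c, i)" "\<omega> (Suc c, i) = \<omega> (c, i + 1)"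
    using orients_straight[OF oriented] by blast+
  ultimately show ?thesis using that b i by blast
qed

text \<open>At a positive crossing the 0-resolution has vertical arcs when the strands point both up
  or both down, and horizontal arcs otherwise; either way each arc joins an entering end to a
  leaving end.\<close>

lemma oriented_0: "orients \<omega> (resolve D {})"
proof -
  have 1: "\<omega> p = \<omega> q" if "straight (resolve D {}) p q" for p q
    using that
  proof cases
    case (through t k k')
    show ?thesis
    proof (cases "t \<in> crossings D")
      case True
      then show ?thesis
      proof (cases rule: crossing)
        case (1 b i)
        show ?thesis
        proof (cases "k = i \<or> k = i + 1")
          case True
          then show ?thesis using 1 through by (auto simp: nth_resolve split: if_splits)
        next
          case False
          then have "passes (snd D ! t) k k'"
            using 1 through by (auto simp: nth_resolve split: if_splits)
          then have "straight D p q" using through straight.through[of t D k k'] by simp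
          then show ?thesis using orients_straight[OF oriented] by blast
        qed
      qed
    next
      case False
      then have "snd (resolve D {}) ! t = snd D ! t"
        using through by (cases "snd D ! t") (auto simp: nth_resolve crossings_def)
      then have "straight D p q" using through straight.through[of t D k k'] by simp
      then show ?thesis using orients_straight[OF oriented] by blast
    qed
  next
    case (antipodal k)
    then show ?thesis
      using orients_straight[OF oriented] straight.antipodal[of k D] by simp
  qed
  have turning_event: "t \<in> crossings D \<or> snd (resolve D {}) ! t = snd D ! t" if "t < height D" for t
    using that by (cases "snd D ! t") (auto simp: nth_resolve crossings_def)
  have 2: "\<omega> p \<noteq> \<omega> q" if "turning (resolve D {}) p q" for p q
    using that
  proof cases
    case (minimum t j)
    then have "t < height D" by simp
    from turning_event[OF this] show ?thesis
    proof
      assume "t \<in> crossings D"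
      then show ?thesis
        by (cases rule: crossing) (use minimum in \<open>auto simp: nth_resolve split: if_splits\<close>)
    next
      assume "snd (resolve D {}) ! t = snd D ! t"
      then have "turning D p q" using minimum turning.minimum[of t D j] by simp
      then show ?thesis using oriented unfolding orients_def by blast
    qed
  next
    case (maximum t j)
    then have "t < height D" by simp
    from turning_event[OF this] show ?thesis
    proof
      assume "t \<in> crossings D"
      then show ?thesis
        by (cases rule: crossing) (use maximum in \<open>auto simp: nth_resolve split: if_splits\<close>)
    next
      assume "snd (resolve D {}) ! t = snd D ! t"
      then have "turning D p q" using maximum turning.maximum[of t D j] by simp
      then show ?thesis using oriented unfolding orients_def by blast
    qed
  qed
  show ?thesis using 1 2 unfolding orients_def by blast
qed

text \<open>Uniqueness holds because the 1-resolution of a positive crossing joins the two entering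
  ends, and likewise the two leaving ends.\<close>

lemma oriented_vertex_eq: "oriented_vertex D \<omega> = {}"
  unfolding oriented_vertex_def
proof (rule the_equality)
  show "{} \<subseteq> crossings D \<and> orients \<omega> (resolve D {})" using oriented_0 by simp
next
  fix v assume v: "v \<subseteq> crossings D \<and> orients \<omega> (resolve D v)"
  show "v = {}"
  proof (rule ccontr)
    assume "v \<noteq> {}"
    then obtain c where c: "c \<in> v" "c \<in> crossings D" using v by blast
    from c(2) show False
    proof (cases rule: crossing)
      case (1 b i)
      show False
      proof (cases b)
        case True
        then have "snd (resolve D v) ! c = Turn i" using 1 c by (simp add: nth_resolve)
        then have "\<omega> (c, i) \<noteq> \<omega> (c, i + 1)"
          using resolve_turn[of c D v i] 1 orients_pair v by blast
        then show False using 1 True by simp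
      next
        case False
        then have "snd (resolve D v) ! c = Vert i" using 1 c by (simp add: nth_resolve)
        then have "\<omega> (c, i) = \<omega> (Suc c, i)"
          using resolve_vert[of c D i v] 1 orients_straight v by blast
        then show False using 1 False by simp
      qed
    qed
  qed
qed

section \<open>The corners of a crossing and the circles near it\<close>

lemma corners_points:
  assumes "c \<in> crossings D"
  shows "corners D c \<subseteq> points D"
  using assms by (cases rule: crossing) (auto simp: corners_def page_defs points_def width_Suc)

lemma local_up_eq:
  assumes "c \<in> crossings D" "p \<in> corners D c"
  shows "local_up D A c p = \<omega> p"
  using assms(1)
  by (cases rule: crossing)
    (use assms local_orientation[OF assms(1)] in
      \<open>auto simp: local_up_def corners_def page_defs\<close>)

text \<open>The condition on \<open>\<omega> p\<close> says that the strand at \<open>p\<close>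
  heads into the crossing: upwards at a lower corner, downwards at an upper one.\<close>

lemma entering_corner:
  assumes "c \<in> crossings D" "p \<in> corners D c" "\<omega> p \<longleftrightarrow> fst p = c"
  shows "p = corner_SW D A c \<or> p = corner_SE D A c"
  using assms(1)
  by (cases rule: crossing)
    (use assms local_orientation[OF assms(1)] in
      \<open>auto simp: corner_defs compass_def corners_def page_defs Let_def split: bool.splits\<close>)

text \<open>In compass directions all crossings look alike: the oriented resolution consists of a
  western and an eastern arc, both travelled northwards.\<close>

lemma successor_corners:
  assumes "c \<in> crossings D"
  shows "successor (resolve D {}) \<omega> (corner_SW D A c) (corner_NW D A c) \<and>
    successor (resolve D {}) \<omega> (corner_SE D A c) (corner_NE D A c)"
  using assms
proof (cases rule: crossing)
  case (1 b i)
  show ?thesis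
  proof (cases b)
    case True
    then have e: "snd (resolve D {}) ! c = Vert i" using 1 by (simp add: nth_resolve)
    show ?thesis
      using 1 True resolve_vert[OF 1(2,3) e] local_orientation[OF assms]
      by (auto simp: corner_defs compass_def page_defs Let_def successor_def upper_def lower_def
          split: bool.splits)
  next
    case False
    then have e: "snd (resolve D {}) ! c = Turn i" using 1 by (simp add: nth_resolve)
    show ?thesis
      using 1 False resolve_turn[OF 1(2) e] local_orientation[OF assms]
      by (auto simp: corner_defs compass_def page_defs Let_def successor_def upper_def lower_def
          pair_sym split: bool.splits)
  qed
qed

lemma joined_corners:
  assumes "c \<in> crossings D" "c \<in> v"
  shows "equivclp (joined (resolve D v)) (corner_SW D A c) (corner_SE D A c) \<and>
    equivclp (joined (resolve D v)) (corner_NW D A c) (corner_NE D A c)"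
  using assms(1)
proof (cases rule: crossing)
  case (1 b i)
  have sym: "equivclp r x y \<longleftrightarrow> equivclp r y x" for r and x y :: point
    by (blast intro: equivclp_sym)
  show ?thesis
  proof (cases b)
    case True
    then have e: "snd (resolve D v) ! c = Turn i" using 1 assms by (simp add: nth_resolve)
    have "equivclp (joined (resolve D v)) (c, i) (c, i + 1)"
      "equivclp (joined (resolve D v)) (Suc c, i) (Suc c, i + 1)"
      using resolve_turn[OF 1(2) e] turning_iff equivclp_step unfolding joined_def by metis+
    then show ?thesis
      using 1 True local_orientation[OF assms(1)] sym
      by (auto simp: corner_defs compass_def page_defs Let_def split: bool.splits)
  next
    case False
    then have e: "snd (resolve D v) ! c = Vert i" using 1 assms by (simp add: nth_resolve)
    have "equivclp (joined (resolve D v)) (c, i) (Suc c, i)"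
      "equivclp (joined (resolve D v)) (c, i + 1) (Suc c, i + 1)"
      using resolve_vert[OF 1(2,3) e] equivclp_step unfolding joined_def by metis+
    then show ?thesis
      using 1 False local_orientation[OF assms(1)] sym
      by (auto simp: corner_defs compass_def page_defs Let_def split: bool.splits)
  qed
qed

text \<open>Only the two steps of travel through \<open>c\<close> itself are lost when the
  resolution of \<open>c\<close> is changed, and these start at SW and SE.\<close>

lemma successor_resolve:
  assumes "c \<in> crossings D" "successor (resolve D {}) \<omega> p q"
    and "p \<noteq> corner_SW D A c" "p \<noteq> corner_SE D A c"
  shows "equivclp (joined (resolve D {c})) p q"
proof -
  obtain b i where c: "snd D ! c = Cross b i" using assms(1) by (rule crossing)
  have "successor (resolve D {c}) \<omega> p q"
    using assms(2) entering_corner[OF assms(1), of p] assms(3,4)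
      upper_resolve_insert[OF c, of "{}" p q] lower_resolve_insert[OF c, of "{}" p q]
    unfolding successor_def by (auto split: if_splits)
  then show ?thesis by (intro equivclp_step successor_joined)
qed

lemma near_0:
  assumes "c \<in> crossings D"
  shows "near D {} c = {circle_of (resolve D {}) (corner_SW D A c), circle_of (resolve D {}) (corner_SE D A c)}"
    and "circle_of (resolve D {}) (corner_NW D A c) = circle_of (resolve D {}) (corner_SW D A c)"
    and "circle_of (resolve D {}) (corner_NE D A c) = circle_of (resolve D {}) (corner_SE D A c)"
proof -
  show 2: "circle_of (resolve D {}) (corner_NW D A c) = circle_of (resolve D {}) (corner_SW D A c)"
    and 3: "circle_of (resolve D {}) (corner_NE D A c) = circle_of (resolve D {}) (corner_SE D A c)"
    using successor_corners[OF assms] successor_joined equivclp_step circle_of_eq by metis+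
  show "near D {} c =
      {circle_of (resolve D {}) (corner_SW D A c), circle_of (resolve D {}) (corner_SE D A c)}"
    unfolding near_eq[OF corners_points[OF assms]] corners_compass[of D c A] by (auto simp: 2 3)
qed

text \<open>This rules out 1-2 bifurcations. After the change SW is connected to SE and NW to NE; it
  remains to connect one pair to the other.\<close>

lemma card_near_1:
  assumes "c \<in> crossings D"
  shows "card (near D {c} c) = 1"
proof -
  let ?E = "resolve D {c}"
  let ?C = "circle_of ?E (corner_NW D A c)"
  have 1: "circle_of ?E (corner_SW D A c) = circle_of ?E (corner_SE D A c)"
    "?C = circle_of ?E (corner_NE D A c)"
    using joined_corners[OF assms] circle_of_eq by blast+
  \<comment> \<open>Otherwise \<open>?C\<close> would be closed under the successor map of the
    oriented resolution, although that map enters \<open>?C\<close> at NW from SW outside;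
    injectivity on a finite set forbids this.\<close>
  have "corner_SW D A c \<in> ?C \<or> corner_SE D A c \<in> ?C"
  proof (rule ccontr)
    assume no: "\<not> ?thesis"
    have "corner_NW D A c \<in> points D"
      using corners_points[OF assms] corners_compass[of D c A] by blast
    then have "?C \<subseteq> points (resolve D {})"
      using equivclp_joined_points[of ?E] diagram unfolding circle_of_def by fastforce
    moreover have "corner_SW D A c \<notin> ?C" using no by blast
    moreover have "well_formed (resolve D {})" using diagram by simp
    ultimately obtain x y where "x \<in> ?C" "successor (resolve D {}) \<omega> x y" "y \<notin> ?C"
      using successor_leaves[OF _ oriented_0 _ conjunct1[OF successor_corners[OF assms]] _ circle_of_self]
      by metis
    moreover from this have "equivclp (joined ?E) x y"
      using successor_resolve[OF assms] no by blast
    ultimately show False unfolding circle_of_def by (blast intro: equivclp_trans)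
  qed
  then have "circle_of ?E (corner_SW D A c) = ?C"
    using 1 circle_of_eq unfolding circle_of_def by blast
  then have "near D {c} c = {?C}"
    unfolding near_eq[OF corners_points[OF assms]] corners_compass[of D c A] using 1 by auto
  then show ?thesis by simp
qed

section \<open>Signs comparing \<open>\<omega>\<close> with the chosen orientations of the
  circles\<close>

definition agreement :: "point set \<Rightarrow> rat" where
  "agreement C = (if \<forall>p\<in>C. \<omega> p = circle_dir A {} p then 1 else - 1)"

text \<open>\<open>agreement C\<close> is the sign of X in the factor at \<open>C\<close> of the Lee
  generator of \<open>\<omega>\<close>; any single point of the circle decides it.\<close>

lemma agreement_point:
  assumes "p \<in> points D"
  shows "agreement (circle_of (resolve D {}) p) = (if \<omega> p = circle_dir A {} p then 1 else - 1)"
  using orientations_on_circle[OF oriented_0, of "circle_dir A {}" "circle_of (resolve D {}) p" p]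
    choices assms circle_of_circles[of p "resolve D {}"]
  by (auto simp: agreement_def auxiliary_choices_def)

text \<open>A circle is nonempty and agreement is constant along it, so failing to agree with
  \<open>\<omega>\<close> everywhere means agreeing with the opposite everywhere.\<close>

lemma agreement_opposite:
  assumes "C \<in> circles (resolve D {})"
  shows "(if \<forall>p\<in>C. opposite \<omega> p = circle_dir A {} p then 1 else - 1) = - agreement C"
proof -
  obtain p where "p \<in> C"
    using assms circle_of_self unfolding circles_def circle_of_def by blast
  moreover have "orients (opposite \<omega>) (resolve D {})"
    using oriented_0 by (auto simp: orients_def opposite_def)
  moreover have "orients (circle_dir A {}) (resolve D {})"
    using choices by (simp add: auxiliary_choices_def)
  ultimately show ?thesis
    using orientations_on_circle[of _ _ _ C p] assms oriented_0
    unfolding agreement_def by (simp add: opposite_def)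
qed

section \<open>Cancellation in a 2-1 bifurcation merging a western circle \<open>W\<close> and an
  eastern circle \<open>V\<close>\<close>

context
  fixes c :: nat and W V :: "point set"
  assumes c: "c \<in> crossings D"
  defines "W \<equiv> circle_of (resolve D {}) (corner_SW D A c)"
    and "V \<equiv> circle_of (resolve D {}) (corner_SE D A c)"
  assumes distinct_near: "W \<noteq> V"
begin

lemma near_WV: "near D {} c = {W, V}"
  using near_0(1)[OF c] by (simp add: W_def V_def)

lemma WV_circles: "W \<in> circles (resolve D {})" "V \<in> circles (resolve D {})"
  using near_WV by (auto simp: near_def)

lemma corners_in_WV:
  "corner_SW D A c \<in> W" "corner_NW D A c \<in> W" "corner_NE D A c \<in> V" "corner_NE D A c \<notin> W"
  "corner_NW D A c \<notin> V" "corner_SW D A c \<notin> V"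
proof -
  show 1: "corner_SW D A c \<in> W" "corner_NW D A c \<in> W" "corner_NE D A c \<in> V"
    using near_0(2,3)[OF c] circle_of_self unfolding W_def V_def by metis+
  have "p \<notin> V" if "p \<in> W" for p
    using that WV_circles circles_unique distinct_near by metis
  then show "corner_NE D A c \<notin> W" "corner_NW D A c \<notin> V" "corner_SW D A c \<notin> V"
    using 1 by blast+
qed

text \<open>In the Lee generator of \<open>\<omega>\<close>, after the sign (C), the circle \<open>W\<close> to the west carries the
  label \<open>b\<close> and the circle \<open>V\<close> to the east carries \<open>a\<close>, however the circles are oriented.\<close>

lemma consistent_W: "consistent D A {} c W \<longleftrightarrow> agreement W = - 1"
  and consistent_V: "consistent D A {} c V \<longleftrightarrow> agreement V = 1"
proof -
  have p: "corner_SW D A c \<in> corners D c" "corner_NE D A c \<in> corners D c"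
    using corners_compass[of D c A] by blast+
  \<comment> \<open>\<open>consistent\<close> inspects only the corners NE and SW, so
    \<open>V\<close> has to be represented by NE.\<close>
  have V: "V = circle_of (resolve D {}) (corner_NE D A c)"
    using near_0(3)[OF c] by (simp add: V_def)
  have points: "corner_SW D A c \<in> points D" "corner_NE D A c \<in> points D"
    using p corners_points[OF c] by blast+
  show "consistent D A {} c W \<longleftrightarrow> agreement W = - 1"
    using corners_in_WV p local_up_eq[OF c p(1)] agreement_point[OF points(1)]
    by (auto simp: consistent_def W_def[symmetric])
  show "consistent D A {} c V \<longleftrightarrow> agreement V = 1"
    using corners_in_WV p local_up_eq[OF c p(2)] agreement_point[OF points(2)]
    by (auto simp: consistent_def V[symmetric])
qed

text \<open>Makes the positions 0 and 1 read by \<open>occurs\<close> explicit: NW lies on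
  \<open>W\<close>, which therefore comes first.\<close>

lemma arranged_WV: "arranged D A {} {} c = W # V # filter (\<lambda>C. C \<in> far D {} c) (circle_order A {})"
proof -
  have d: "distinct (circle_order A {})" "set (circle_order A {}) = circles (resolve D {})"
    using choices by (auto simp: auxiliary_choices_def)
  have "{C \<in> set (circle_order A {}). C \<in> near D {} c \<and> corner_NW D A c \<in> C} = {W}"
    "{C \<in> set (circle_order A {}). C \<in> near D {} c \<and> corner_NW D A c \<notin> C} = {V}"
    using d(2) near_WV WV_circles corners_in_WV by auto
  then show ?thesis
    using d(1) by (simp add: arranged_def filter_singleton)
qed

text \<open>The product of the two near labels and all far labels stay the same, so only the sign
  (C) changes. The minus sign arises because consistency is tested by disagreement at SW but by
  agreement at NE.\<close>

lemma edge_coeff_flip: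
  "edge_coeff D A {} c (flip {W, V} g) h =
    - agreement W * agreement V * edge_coeff D A {} c g h"
proof -
  let ?g = "flip {W, V} g"
  have far: "?g C = g C" if "C \<in> far D {} c" for C
    using that near_WV by (auto simp: far_def flip_def)
  have "occurs D A {} c ?g h = occurs D A {} c g h"
    using card_near_1[OF c] far
    by (simp add: occurs_def Let_def arranged_WV) (simp add: flip_def mult_swap_label)
  moreover have "sign_O D A {} c ?g = sign_O D A {} c g"
    unfolding sign_O_def using far by (metis (mono_tags, lifting))
  moreover have "sign_C D A {} c ?g h = - agreement W * agreement V * sign_C D A {} c g h"
  proof -
    \<comment> \<open>The factor that a label X on the near circle \<open>C\<close> contributes to
      the sign (C).\<close>
    define \<delta> :: "point set \<Rightarrow> rat" where "\<delta> C = (if consistent D A {} c C then 1 else - 1)" for C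
    have *: "(- 1) ^ card {C \<in> near D {} c. \<not> consistent D A {} c C \<and> k C = LX} =
        label_sign {W, V} \<delta> k" for k
      unfolding near_WV label_sign_def \<delta>_def
      by (subst neg_one_power_card) (auto intro!: prod.cong)
    have "\<delta> W = - agreement W" "\<delta> V = agreement V"
      using consistent_W consistent_V by (auto simp: \<delta>_def agreement_def)
    then have "label_sign {W, V} \<delta> ?g = - agreement W * agreement V * label_sign {W, V} \<delta> g"
      using label_sign_flip[of "{W, V}" W V \<delta> g] distinct_near by (simp add: agreement_def)
    then show ?thesis
      unfolding sign_C_def Let_def power_add * by simp
  qed
  ultimately show ?thesis by (simp add: edge_coeff_def)
qed

text \<open>The flip permutes the labellings and negates every summand, so the sum equals its own
  negative.\<close>

lemma sum_edge_coeff_WV: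
  assumes "\<And>g. g \<in> labellings D {} \<Longrightarrow>
    z ({}, flip {W, V} g) = agreement W * agreement V * z ({}, g)"
  shows "(\<Sum>g\<in>labellings D {}. z ({}, g) * edge_coeff D A {} c g h) = 0"
proof -
  let ?S = "\<Sum>g\<in>labellings D {}. z ({}, g) * edge_coeff D A {} c g h"
  have fl: "flip {W, V} g \<in> labellings D {}" if "g \<in> labellings D {}" for g
    using that flip_labellings WV_circles by simp
  have sq: "agreement C * agreement C = 1" for C by (simp add: agreement_def)
  have "?S = (\<Sum>g\<in>labellings D {}. z ({}, flip {W, V} g) * edge_coeff D A {} c (flip {W, V} g) h)"
    by (rule sum.reindex_bij_witness[of _ "flip {W, V}" "flip {W, V}"]) (auto simp: fl)
  also have "\<dots> = (\<Sum>g\<in>labellings D {}. - (z ({}, g) * edge_coeff D A {} c g h))"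
  proof (rule sum.cong[OF refl])
    fix g assume "g \<in> labellings D {}"
    then have "z ({}, flip {W, V} g) * edge_coeff D A {} c (flip {W, V} g) h =
      - ((agreement W * agreement W) * (agreement V * agreement V) *
          (z ({}, g) * edge_coeff D A {} c g h))"
      using assms edge_coeff_flip by (simp add: algebra_simps)
    then show "z ({}, flip {W, V} g) * edge_coeff D A {} c (flip {W, V} g) h =
        - (z ({}, g) * edge_coeff D A {} c g h)" by (simp add: sq)
  qed
  also have "\<dots> = - ?S" by (simp add: sum_negf)
  finally show ?thesis by simp
qed

end

text \<open>If SW and SE lie on one circle, the edge is a 1-1 bifurcation and carries no map;
  otherwise the cancellation for \<open>W\<close> and \<open>V\<close> applies.\<close>

lemma sum_edge_coeff:
  assumes "c \<in> crossings D"
    and "\<And>W V g. W \<in> circles (resolve D {}) \<Longrightarrow> V \<in> circles (resolve D {}) \<Longrightarrow> W \<noteq> V \<Longrightarrow>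
      g \<in> labellings D {} \<Longrightarrow> z ({}, flip {W, V} g) = agreement W * agreement V * z ({}, g)"
  shows "(\<Sum>g\<in>labellings D {}. z ({}, g) * edge_coeff D A {} c g h) = 0"
proof (cases "circle_of (resolve D {}) (corner_SW D A c) = circle_of (resolve D {}) (corner_SE D A c)")
  case True
  then have "card (near D {} c) = 1" using near_0(1)[OF assms(1)] by simp
  then have "edge_coeff D A {} c g h = 0" for g
    using card_near_1[OF assms(1)] by (simp add: edge_coeff_def occurs_def Let_def)
  then show ?thesis by simp
next
  case False
  then show ?thesis
    using sum_edge_coeff_WV[OF assms(1) False] assms(2) WV_circles[OF assms(1) False] by blast
qed

section \<open>The two combinations of Lee generators, their gradings and the s-invariant\<close>

definition num_X :: "labelling \<Rightarrow> nat" where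
  "num_X g = card {C \<in> circles (resolve D {}). g C = LX}"

text \<open>The values 1 and -1 of \<open>\<epsilon>\<close> give the sum and the difference in the
  s-invariant.\<close>

definition lee_combination :: "rat \<Rightarrow> chain" where
  "lee_combination \<epsilon> = (\<lambda>g. lee_generator D {} (circle_dir A {}) \<omega> g +
     \<epsilon> * lee_generator D {} (circle_dir A {}) (opposite \<omega>) g)"

text \<open>The product form exhibits the support, which depends on the parity of
  \<open>num_X g\<close>; the sum form suits the proof that the combination is a cycle.\<close>

lemma lee_combination_eq:
  assumes "g \<in> labellings D {}"
  shows "lee_combination \<epsilon> ({}, g) =
      label_sign (circles (resolve D {})) agreement g * (1 + \<epsilon> * (- 1) ^ num_X g)"
    and "lee_combination \<epsilon> ({}, g) = label_sign (circles (resolve D {})) agreement g +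
      \<epsilon> * label_sign (circles (resolve D {})) (\<lambda>C. - agreement C) g"
proof -
  let ?S = "circles (resolve D {})"
  have 1: "lee_generator D {} (circle_dir A {}) \<omega> ({}, g) = label_sign ?S agreement g"
    using assms by (simp add: lee_generator_eq agreement_def[abs_def])
  have 2: "lee_generator D {} (circle_dir A {}) (opposite \<omega>) ({}, g) =
      label_sign ?S (\<lambda>C. - agreement C) g"
    unfolding lee_generator_eq[OF assms] label_sign_def
    by (intro prod.cong refl) (simp only: agreement_opposite)
  have 3: "label_sign ?S (\<lambda>C. - agreement C) g = (- 1) ^ num_X g * label_sign ?S agreement g"
    unfolding label_sign_def num_X_def neg_one_power_card[OF finite_circles] prod.distrib[symmetric]
    by (intro prod.cong) auto
  show "lee_combination \<epsilon> ({}, g) = label_sign ?S agreement g +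
      \<epsilon> * label_sign ?S (\<lambda>C. - agreement C) g"
    by (simp add: lee_combination_def 1 2)
  then show "lee_combination \<epsilon> ({}, g) = label_sign ?S agreement g * (1 + \<epsilon> * (- 1) ^ num_X g)"
    by (simp add: 3 algebra_simps)
qed

lemma lee_combination_support:
  "lee_combination \<epsilon> (v, g) \<noteq> 0 \<Longrightarrow> v = {} \<and> g \<in> labellings D {}"
  by (auto simp: lee_combination_def lee_generator_def split: if_splits)

text \<open>Flipping two labels multiplies the coefficients of both Lee generators by the same
  factor, as the two signs of the opposite orientation cancel.\<close>

lemma lee_combination_cycle: "lee_combination \<epsilon> \<in> cycles D A"
proof -
  have "lee_combination \<epsilon> ({}, flip {W, V} g) = agreement W * agreement V * lee_combination \<epsilon> ({}, g)"
    if "W \<in> circles (resolve D {})" "V \<in> circles (resolve D {})" "W \<noteq> V" "g \<in> labellings D {}"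
    for W V g
  proof -
    have "flip {W, V} g \<in> labellings D {}" using that flip_labellings by simp
    moreover have "label_sign (circles (resolve D {})) agreement (flip {W, V} g) =
        agreement W * agreement V * label_sign (circles (resolve D {})) agreement g"
      by (rule label_sign_flip) (use that in \<open>auto simp: finite_circles agreement_def\<close>)
    moreover have "label_sign (circles (resolve D {})) (\<lambda>C. - agreement C) (flip {W, V} g) =
        (- agreement W) * (- agreement V) * label_sign (circles (resolve D {})) (\<lambda>C. - agreement C) g"
      by (rule label_sign_flip) (use that in \<open>auto simp: finite_circles agreement_def\<close>)
    ultimately show ?thesis
      using that(4) by (simp add: lee_combination_eq(2) algebra_simps)
  qed
  then have "differential D A (lee_combination \<epsilon>) = (\<lambda>_. 0)"
    by (intro differential_eq_0 sum_edge_coeff) (use lee_combination_support in blast)+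
  moreover have "lee_combination \<epsilon> \<in> chains D"
    using lee_combination_support by (fastforce simp: chains_def generators_def)
  ultimately show ?thesis by (simp add: cycles_def)
qed

lemma quantum_grading_origin:
  "quantum_grading D \<omega> ({}, g) =
    int (card (crossings D)) + int (card (circles (resolve D {}))) - 2 * int (num_X g)"
proof -
  let ?S = "circles (resolve D {})"
  have "?S = {C \<in> ?S. g C = L1} \<union> {C \<in> ?S. g C = LX}" using label.exhaust by auto
  then have "card ?S = card ({C \<in> ?S. g C = L1} \<union> {C \<in> ?S. g C = LX})" by simp
  also have "\<dots> = card {C \<in> ?S. g C = L1} + num_X g"
    unfolding num_X_def using finite_circles by (intro card_Un_disjoint) auto
  finally have "card ?S = card {C \<in> ?S. g C = L1} + num_X g" .
  moreover have "{c \<in> crossings D. positive_crossing D \<omega> c} = crossings D"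
    "{c \<in> crossings D. \<not> positive_crossing D \<omega> c} = {}"
    using positive by (auto simp: positive_diagram_def)
  then have "n_pos D \<omega> = card (crossings D)" "n_neg D \<omega> = 0"
    by (simp_all only: n_pos_def n_neg_def card.empty)
  ultimately show ?thesis
    by (simp add: quantum_grading_def num_X_def)
qed

text \<open>Each X lowers the grading by 2, so the minimum is attained at the largest number
  \<open>k\<close> of labels X with nonzero coefficient.\<close>

lemma q_class_lee_combination:
  assumes "k \<le> card (circles (resolve D {}))" "1 + \<epsilon> * (- 1) ^ k \<noteq> 0"
    and "\<And>l. l \<le> card (circles (resolve D {})) \<Longrightarrow> 1 + \<epsilon> * (- 1) ^ l \<noteq> 0 \<Longrightarrow> l \<le> k"
  shows "q_class D \<omega> (homology_class D A (lee_combination \<epsilon>)) =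
    int (card (crossings D)) + int (card (circles (resolve D {}))) - 2 * int k"
proof -
  let ?S = "circles (resolve D {})"
  have nz: "label_sign ?S agreement g \<noteq> 0" for g
    unfolding label_sign_def by (auto simp: finite_circles agreement_def)
  obtain T where T: "T \<subseteq> ?S" "card T = k" using obtain_subset_with_card_n[OF assms(1)] by blast
  \<comment> \<open>X is placed on exactly \<open>k\<close> circles; \<open>undefined\<close>
    elsewhere makes \<open>g\<close> extensional, as \<open>labellings\<close> requires.\<close>
  define g where "g = (\<lambda>C. if C \<in> ?S then if C \<in> T then LX else L1 else undefined)"
  have "{C \<in> ?S. g C = LX} = T" using T(1) by (auto simp: g_def)
  then have g: "g \<in> labellings D {}" "num_X g = k"
    using T by (auto simp: num_X_def labellings_def g_def PiE_iff extensional_def)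
  have "q_class D \<omega> (homology_class D A (lee_combination \<epsilon>)) = quantum_grading D \<omega> ({}, g)"
  proof (rule q_class_origin[OF lee_combination_cycle])
    show "v = {}" if "lee_combination \<epsilon> (v, g') \<noteq> 0" for v g'
      using that lee_combination_support by blast
    show "lee_combination \<epsilon> ({}, g) \<noteq> 0"
      using g nz assms(2) by (simp add: lee_combination_eq(1))
    fix g' assume z: "lee_combination \<epsilon> ({}, g') \<noteq> 0"
    then have "1 + \<epsilon> * (- 1) ^ num_X g' \<noteq> 0"
      using lee_combination_support[OF z] by (auto simp: lee_combination_eq(1))
    moreover have "num_X g' \<le> card ?S"
      unfolding num_X_def by (intro card_mono finite_circles) auto
    ultimately show "quantum_grading D \<omega> ({}, g) \<le> quantum_grading D \<omega> ({}, g')"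
      using assms(3) g(2) by (simp add: quantum_grading_origin)
  qed
  then show ?thesis by (simp add: quantum_grading_origin g(2))
qed

lemma s_invariant_eq:
  assumes "points D \<noteq> {}"
  shows "s_invariant D \<omega> A =
    of_nat (card (crossings D)) - of_nat (card (circles (resolve D {}))) + 1"
proof -
  define n r where "n = card (crossings D)" and "r = card (circles (resolve D {}))"
  have "circles (resolve D {}) \<noteq> {}"
    using assms circle_of_circles[of _ "resolve D {}"] by auto
  then have r: "r > 0" using finite_circles by (auto simp: r_def card_gt_0_iff)
  \<comment> \<open>\<open>P\<close> is the parity condition on the number of labels X. It
    alternates, so the largest admissible number is \<open>r\<close> or \<open>r - 1\<close>, where
    \<open>r > 0\<close> makes the latter a true predecessor.\<close>
  have q: "q_class D \<omega> (homology_class D A (lee_combination \<epsilon>)) =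
      int n + int r - 2 * (if P r then int r else int r - 1)"
    if "\<And>l. 1 + \<epsilon> * (- 1) ^ l \<noteq> 0 \<longleftrightarrow> P l" "\<And>l. P (Suc l) \<longleftrightarrow> \<not> P l" for \<epsilon> and P :: "nat \<Rightarrow> bool"
  proof (cases "P r")
    case True
    then show ?thesis
      using q_class_lee_combination[of r \<epsilon>] that(1) unfolding n_def r_def by simp
  next
    case False
    then have P: "P (r - 1)" using that(2)[of "r - 1"] r by simp
    have "l \<le> r - 1" if "l \<le> r" "P l" for l using that False by (cases "l = r") auto
    then show ?thesis
      using q_class_lee_combination[of "r - 1" \<epsilon>] that(1) P False r
      unfolding n_def[symmetric] r_def[symmetric] by simp
  qed
  have "1 + 1 * (- 1) ^ l \<noteq> (0 :: rat) \<longleftrightarrow> even l"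
    and "1 + - 1 * (- 1) ^ l \<noteq> (0 :: rat) \<longleftrightarrow> odd l" for l
    by (cases "even l"; simp)+
  then have "q_class D \<omega> (homology_class D A (lee_combination 1)) =
      int n + int r - 2 * (if even r then int r else int r - 1)"
    "q_class D \<omega> (homology_class D A (lee_combination (- 1))) =
      int n + int r - 2 * (if odd r then int r else int r - 1)"
    by (intro q; simp)+
  \<comment> \<open>Whatever the parity of \<open>r\<close>, one combination reaches
    \<open>r\<close> labels X and the other \<open>r - 1\<close>, so the sum does not depend on
    it.\<close>
  then have "q_class D \<omega> (homology_class D A (lee_combination 1)) +
      q_class D \<omega> (homology_class D A (lee_combination (- 1))) = 2 * (int n - int r + 1)"
    by (cases "even r") auto
  then have "(of_int (q_class D \<omega> (homology_class D A (lee_combination 1))) +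
      of_int (q_class D \<omega> (homology_class D A (lee_combination (- 1))))) / 2 =
      (of_nat n - of_nat r + 1 :: rat)"
    unfolding of_int_add[symmetric] by simp
  then show ?thesis
    unfolding s_invariant_def oriented_vertex_eq Let_def lee_combination_def n_def[symmetric]
      r_def[symmetric] by simp
qed

end

theorem theorem1p6:
  fixes D :: diagram and \<omega> :: orientation and A :: aux and n r :: nat
  assumes "knot_diagram D"
    and "orients \<omega> D"
    and "positive_diagram D \<omega>"
    and "n = card (crossings D)"
    and "r = card (circles (oriented_resolution D \<omega>))"
    and "lee_choices D \<omega> A"
  shows "s_invariant D \<omega> A = of_nat n - of_nat r + 1"
proof -
  interpret positive_choices D \<omega> A
    using assms by unfold_locales
      (auto simp: knot_diagram_def link_diagram_def lee_choices_def)
  \<comment> \<open>A knot diagram has a circle and hence a point, which ensures that the oriented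
    resolution has at least one circle.\<close>
  have "points D \<noteq> {}"
    using assms(1) by (auto simp: knot_diagram_def circles_def)
  then show ?thesis
    using s_invariant_eq assms(4,5) by (simp add: oriented_resolution_def oriented_vertex_eq)
qed

end
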